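(* There exists $f\in C_0(\Omega)$ such that $S_f$ is continuous on $\mathbb R$, $\alpha_{f,\min}^*=-1$, $\alpha_{f,\max}^*=1$, $\partial^-S_f(\alpha_{f,\max}^* )>-\infty$ and $\partial^+S_f(\alpha_{f,\min}^* )<\infty$. Moreover, these derivatives can be arbitrarily close to $-1$ and $1$, respectively: for every $\eta>0$ there is such an $f$ which in addition satisfies $|\partial^-S_f(\alpha_{f,\max}^* )+1|<\eta$ and $|\partial^+S_f(\alpha_{f,\min}^* )-1|<\eta$.
   Context: $\Omega=\{0,1\}^{\mathbb N}$ ($\mathbb N=\{1,2,\dots\}$) with the metric $d(\omega,\omega')=\sum_{k\ge1}|\omega_k-\omega'_k|2^{-k}$; $\sigma:\Omega\to\Omega$ is the one-sided shift, $(\sigma\omega)_k=\omega_{k+1}$. $C(\Omega)$ is the space of continuous functions $\Omega\to\mathbb R$; $\lambda$ is the $(1/2,1/2)$-Bernoulli product measure on $\Omega$, and $C_0(\Omega)=\{f\in C(\Omega):\int_\Omega f\,d\lambda=0\}$. For $f\in C(\Omega)$ and $\alpha\in\mathbb R$, $E_f(\alpha)=\{\omega\in\Omega:\lim_{N\to\infty}\frac1N\sum_{n=1}^N f(\sigma^n\omega)=\alpha\}$ and the Birkhoff spectrum is $S_f:\mathbb R\to[0,1]$, $S_f(\alpha)=\dim_H E_f(\alpha)$ (Hausdorff dimension with respect to $d$; $\dim_H\emptyset=0$). $\alpha_{f,\max}^*=\sup\{\alpha\in\mathbb R:E_f(\alpha)\ne\emptyset\}$ and $\alpha_{f,\min}^*=\inf\{\alpha\in\mathbb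 R:E_f(\alpha)\ne\emptyset\}$. For $\varphi:\mathbb R\to\mathbb R$, $\partial^-\varphi(\alpha)$ and $\partial^+\varphi(\alpha)$ denote the left-hand and right-hand derivatives of $\varphi$ at $\alpha$, as limits of difference quotients in $[-\infty,\infty]$. *)

theory Defs
  imports "HOL-Probability.Probability"
begin

definition ediam :: "('a \<Rightarrow> 'a \<Rightarrow> real) \<Rightarrow> 'a set \<Rightarrow> ennreal" where
  "ediam d U = (SUP x\<in>U. SUP y\<in>U. ennreal (d x y))"

text \<open>The summand \<open>(diam U)\<^sup>s\<close>, with the conventions that it is \<open>0\<close> for the empty set and that
  \<open>0\<^sup>0 = 1\<close> for singletons (in contrast to \<open>0 powr 0 = 0\<close>). It is only used for sets of finite
  diameter, so that \<^const>\<open>enn2real\<close> loses no information.\<close>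

definition diam_powr :: "('a \<Rightarrow> 'a \<Rightarrow> real) \<Rightarrow> real \<Rightarrow> 'a set \<Rightarrow> ennreal" where
  "diam_powr d s U =
     (if U = {} then 0 else if s = 0 then 1 else ennreal (enn2real (ediam d U) powr s))"

definition hausdorff_premeasure ::
    "('a \<Rightarrow> 'a \<Rightarrow> real) \<Rightarrow> real \<Rightarrow> real \<Rightarrow> 'a set \<Rightarrow> ennreal" where
  "hausdorff_premeasure d s \<delta> A =
     (INF U\<in>{U :: nat \<Rightarrow> 'a set. A \<subseteq> (\<Union>i. U i) \<and> (\<forall>i. ediam d (U i) \<le> ennreal \<delta>)}.
        \<Sum>i. diam_powr d s (U i))"

definition hausdorff_measure :: "('a \<Rightarrow> 'a \<Rightarrow> real) \<Rightarrow> real \<Rightarrow> 'a set \<Rightarrow> ennreal" where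
  "hausdorff_measure d s A = (SUP \<delta>\<in>{0<..}. hausdorff_premeasure d s \<delta> A)"

definition hausdorff_dim :: "('a \<Rightarrow> 'a \<Rightarrow> real) \<Rightarrow> 'a set \<Rightarrow> ennreal" where
  "hausdorff_dim d A = Inf {ennreal s |s. 0 \<le> s \<and> hausdorff_measure d s A = 0}"

text \<open>Coordinates are numbered from \<open>0\<close>: the coordinate \<open>\<omega>\<^sub>k\<close> (\<open>k \<ge> 1\<close>) of the
  mathematical notation is \<open>\<omega> (k - 1)\<close>, and the symbols \<open>0\<close>, \<open>1\<close> are \<^const>\<open>False\<close>, \<^const>\<open>True\<close>.\<close>

type_synonym omega = "nat \<Rightarrow> bool"

definition dist_omega :: "omega \<Rightarrow> omega \<Rightarrow> real" where
  "dist_omega \<omega> \<omega>' = (\<Sum>k. \<bar>of_bool (\<omega> k) - of_bool (\<omega>' k)\<bar> * (1 / 2) ^ Suc k)"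

lemma summable_dist_omega:
  "summable (\<lambda>k. \<bar>of_bool (\<omega> k) - of_bool (\<omega>' k)\<bar> * (1 / 2 :: real) ^ Suc k)"
proof (rule summable_comparison_test')
  show "summable (\<lambda>k. (1 / 2 :: real) ^ Suc k)"
    using summable_geometric[of "1 / 2 :: real"] by (subst summable_Suc_iff) simp
qed (auto simp: of_bool_def)

lemma Metric_space_dist_omega: "Metric_space UNIV dist_omega"
proof
  fix x y z :: omega
  show "0 \<le> dist_omega x y"
    unfolding dist_omega_def by (intro suminf_nonneg summable_dist_omega) simp
  show "dist_omega x y = dist_omega y x"
    unfolding dist_omega_def by (simp add: abs_minus_commute)
  show "(dist_omega x y = 0) = (x = y)"
    unfolding dist_omega_def
    by (subst suminf_eq_zero_iff[OF summable_dist_omega])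
       (auto simp: fun_eq_iff of_bool_def split: if_splits)
  show "dist_omega x z \<le> dist_omega x y + dist_omega y z"
    unfolding dist_omega_def suminf_add[OF summable_dist_omega summable_dist_omega]
  proof (intro suminf_le summable_add summable_dist_omega)
    fix k
    show "\<bar>of_bool (x k) - of_bool (z k)\<bar> * (1 / 2 :: real) ^ Suc k
        \<le> \<bar>of_bool (x k) - of_bool (y k)\<bar> * (1 / 2) ^ Suc k
          + \<bar>of_bool (y k) - of_bool (z k)\<bar> * (1 / 2) ^ Suc k"
      by (auto simp: of_bool_def)
  qed
qed

definition shift :: "omega \<Rightarrow> omega" where
  "shift \<omega> = (\<lambda>k. \<omega> (Suc k))"

definition C_omega :: "(omega \<Rightarrow> real) set" where
  "C_omega = {f. continuous_map (Metric_space.mtopology UNIV dist_omega) euclidean f}"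

definition bernoulli_omega :: "omega measure" where
  "bernoulli_omega = PiM UNIV (\<lambda>_. measure_pmf (bernoulli_pmf (1 / 2)))"

definition C0_omega :: "(omega \<Rightarrow> real) set" where
  "C0_omega = {f \<in> C_omega. (\<integral>\<omega>. f \<omega> \<partial>bernoulli_omega) = 0}"

definition E_set :: "(omega \<Rightarrow> real) \<Rightarrow> real \<Rightarrow> omega set" where
  "E_set f \<alpha> = {\<omega>. (\<lambda>N. (1 / real N) * (\<Sum>n=1..N. f ((shift ^^ n) \<omega>))) \<longlonglongrightarrow> \<alpha>}"

text \<open>The dimension lies in \<open>[0, 1]\<close>, so that \<^const>\<open>enn2real\<close> loses no information.\<close>

definition birkhoff_spectrum :: "(omega \<Rightarrow> real) \<Rightarrow> real \<Rightarrow> real" where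
  "birkhoff_spectrum f \<alpha> = enn2real (hausdorff_dim dist_omega (E_set f \<alpha>))"

text \<open>For \<open>f \<in> C_omega\<close> the sets below are nonempty (\<open>f\<close> evaluated at a fixed point of the shift
  belongs to them) and bounded, so the real supremum and infimum are the intended ones.\<close>

definition alpha_max :: "(omega \<Rightarrow> real) \<Rightarrow> real" where
  "alpha_max f = Sup {\<alpha>. E_set f \<alpha> \<noteq> {}}"

definition alpha_min :: "(omega \<Rightarrow> real) \<Rightarrow> real" where
  "alpha_min f = Inf {\<alpha>. E_set f \<alpha> \<noteq> {}}"

definition has_left_deriv :: "(real \<Rightarrow> real) \<Rightarrow> real \<Rightarrow> ereal \<Rightarrow> bool" where
  "has_left_deriv \<phi> a L \<longleftrightarrow> ((\<lambda>x. ereal ((\<phi> x - \<phi> a) / (x - a))) \<longlongrightarrow> L) (at_left a)"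

definition has_right_deriv :: "(real \<Rightarrow> real) \<Rightarrow> real \<Rightarrow> ereal \<Rightarrow> bool" where
  "has_right_deriv \<phi> a R \<longleftrightarrow> ((\<lambda>x. ereal ((\<phi> x - \<phi> a) / (x - a))) \<longlongrightarrow> R) (at_right a)"

end

theory Submission
  imports Defs "HOL-Library.Omega_Words_Fun"
begin

text \<open>The function is a Hofbauer-type potential: on a run of ones of remaining length \<open>k\<close> it
  equals \<open>1 - a k\<close>, on a run of zeros \<open>a k - 1\<close>, where \<open>a k = 1\<close> up to a large threshold \<open>m\<close> and
  \<open>a k \<approx> 2 / (k ln 2)\<close> afterwards. Exchanging zeros and ones changes its sign, so its mean is \<open>0\<close>.
  Since \<open>a\<close> decays so slowly, long runs of ones are expensive, and for every \<open>\<tau> > 1\<close> and suitable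
  \<open>m\<close> the transfer operator with weight \<open>2 powr (- \<tau> * (1 - f))\<close> has a positive subinvariant
  function (the pressure is frozen at inverse temperature \<open>\<tau>\<close>). Counting words with its help
  gives \<open>S \<alpha> \<le> \<tau> * (1 - \<bar>\<alpha>\<bar>)\<close>.

  In the other direction, the spectrum of a continuous function is the exponential growth rate of the
  number of words with prescribed averages (Moran construction), hence concave by concatenation
  of words; as \<open>S 0 = 1\<close>, this gives \<open>S \<alpha> \<ge> 1 - \<bar>\<alpha>\<bar>\<close>. Concavity also yields the existence of
  the one-sided derivatives, which then lie in \<open>[-\<tau>, -1]\<close> and \<open>[1, \<tau>]\<close>.\<close>

section \<open>Sublinear sequences\<close>

text \<open>Why the costs decay like \<open>1 / k\<close>: in a sequence that consists mostly of
  ones, in runs of length of order \<open>k\<close>, each run leaves about \<open>log 2 k\<close>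
  bits of freedom. If the costs were summable, a run would lower the sum of f by a bounded amount
  only, and the ratio of entropy to deficit, which is the slope of the spectrum at 1, would blow up
  with \<open>k\<close>. Costs of order \<open>2 / (k ln 2)\<close> add up to about
  \<open>2 * log 2 k\<close> over a run, so the ratio stays bounded. The price is that Birkhoff sums
  have unbounded variation on cylinders; hence all error terms are only o(n). Why a threshold
  \<open>m\<close>: in runs of remaining length at most \<open>m\<close> the function is 0, and each
  letter has weight \<open>x = 2 powr (- \<tau>)\<close>, so the two choices of a letter have total
  weight \<open>2 * x < 1\<close>. This slack, present for every \<tau> > 1, pays for the long runs:
  reaching one takes \<open>m\<close> letters, a factor of order \<open>x ^ m\<close>, against a
  reward of order \<open>m\<close>. The weight only controls sums near the maximum; the other
  endpoint follows by exchanging zeros and ones. Constant sequences are kept out of the estimate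
  because the subinvariant function reads the run length.\<close>

definition sublin :: "(nat \<Rightarrow> real) \<Rightarrow> bool" where
  "sublin u \<longleftrightarrow> (\<forall>\<delta>::real. \<delta> > 0 \<longrightarrow> (\<exists>C::real. \<forall>n. u n \<le> \<delta> * real n + C))"

lemma sublinI: "(\<And>\<delta>::real. \<delta> > 0 \<Longrightarrow> \<exists>C::real. \<forall>n. u n \<le> \<delta> * real n + C) \<Longrightarrow> sublin u"
  by (auto simp: sublin_def)

lemma sublinE:
  assumes "sublin u" "\<delta> > 0"
  obtains C where "C \<ge> 0" "\<And>n. u n \<le> \<delta> * real n + C"
proof -
  obtain C where "\<forall>n. u n \<le> \<delta> * n + C" using assms by (auto simp: sublin_def)
  then have "u n \<le> \<delta> * real n + max C 0" for n by (smt (verit) max_def)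
  then show thesis using that[of "max C 0"] by auto
qed

lemma sublin_const: "sublin (\<lambda>_. c)"
  by (intro sublinI exI[of _ c]) simp

lemma sublin_add:
  assumes "sublin u" "sublin v"
  shows "sublin (\<lambda>n. u n + v n)"
proof (rule sublinI)
  fix \<delta> :: real assume "\<delta> > 0"
  then have d: "\<delta> / 2 > 0" by simp
  obtain C where C: "\<And>n. u n \<le> \<delta> / 2 * real n + C" using sublinE[OF assms(1) d] by metis
  obtain D where D: "\<And>n. v n \<le> \<delta> / 2 * real n + D" using sublinE[OF assms(2) d] by metis
  show "\<exists>C. \<forall>n. u n + v n \<le> \<delta> * real n + C"
  proof (intro exI allI)
    show "u n + v n \<le> \<delta> * real n + (C + D)" for n using C[of n] D[of n] by (simp add: field_simps)
  qed
qed

text \<open>The affine bound holds at every index and increases with it, so it passes to shorter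
  lengths even when \<open>u\<close> is not monotone.\<close>

lemma sublin_compose:
  assumes "sublin u" "\<And>n. h n \<le> n"
  shows "sublin (\<lambda>n. u (h n))"
proof (rule sublinI)
  fix \<delta> :: real assume d: "\<delta> > 0"
  obtain C where C: "\<And>n. u n \<le> \<delta> * real n + C" using sublinE[OF assms(1) d] by metis
  have "u (h n) \<le> \<delta> * real n + C" for n
    using C[of "h n"] mult_left_mono[of "real (h n)" "real n" \<delta>] d assms(2)[of n] by (simp add: order_trans)
  then show "\<exists>C. \<forall>n. u (h n) \<le> \<delta> * real n + C" by blast
qed

lemma sublin_sum:
  assumes v: "v \<longlonglongrightarrow> 0"
  shows "sublin (\<lambda>n. \<Sum>j<n. v j)"
proof (rule sublinI)
  fix \<delta> :: real assume d: "\<delta> > 0"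
  then obtain J where J: "\<And>j. j \<ge> J \<Longrightarrow> \<bar>v j\<bar> < \<delta>"
    using LIMSEQ_D[OF v, of \<delta>] by auto
  have "(\<Sum>j<n. v j) \<le> \<delta> * real n + (\<Sum>j<J. \<bar>v j\<bar>)" for n
  proof -
    have "(\<Sum>j<n. v j) \<le> (\<Sum>j<n. \<delta> + (if j < J then \<bar>v j\<bar> else 0))"
      by (intro sum_mono) (use J d in \<open>force simp: not_less\<close>)
    also have "\<dots> = \<delta> * real n + (\<Sum>j\<in>{..<n} \<inter> {..<J}. \<bar>v j\<bar>)"
      by (simp add: sum.distrib sum.If_cases lessThan_def Int_def)
    also have "(\<Sum>j\<in>{..<n} \<inter> {..<J}. \<bar>v j\<bar>) \<le> (\<Sum>j<J. \<bar>v j\<bar>)"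
      by (intro sum_mono2) auto
    finally show ?thesis by simp
  qed
  then show "\<exists>C. \<forall>n. (\<Sum>j<n. v j) \<le> \<delta> * real n + C" by blast
qed

lemma sublin_tendsto:
  fixes v :: "nat \<Rightarrow> real"
  assumes u: "sublin u" and v: "\<And>n. \<bar>v n\<bar> \<le> u n"
  shows "(\<lambda>n. v n / real n) \<longlonglongrightarrow> 0"
proof (rule LIMSEQ_I)
  fix r :: real assume r: "r > 0"
  obtain C where C: "C \<ge> 0" "\<And>n. u n \<le> r / 2 * real n + C" using sublinE[OF u, of "r / 2"] r by auto
  obtain n0 where n0: "real n0 > 2 * C / r" using reals_Archimedean2 by blast
  have "norm (v n / real n - 0) < r" if n: "n \<ge> Suc n0" for n
  proof -
    have "2 * C / r < real n" using n n0 by linarith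
    then have "2 * C < r * real n" using r by (simp add: field_simps)
    then have "\<bar>v n\<bar> < r * real n" using v[of n] C(2)[of n] by simp
    then show ?thesis using n by (simp add: field_simps)
  qed
  then show "\<exists>n0. \<forall>n\<ge>n0. norm (v n / real n - 0) < r" by blast
qed

lemma sublin_log: "sublin (\<lambda>n. log 2 (real n + 1))"
proof (rule sublinI)
  fix \<delta> :: real assume d: "\<delta> > 0"
  \<comment> \<open>The inequality \<open>ln y \<le> y - 1\<close> at
    \<open>y = c * (n + 1)\<close>; this \<open>c\<close> gives the bound slope \<delta> after
    passing to base 2.\<close>
  define c where "c = \<delta> * ln 2"
  have c: "c > 0" using d by (simp add: c_def)
  have "log 2 (real n + 1) \<le> \<delta> * real n + (\<delta> - 1 / ln 2 - ln c / ln 2)" for n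
  proof -
    have "ln (c * (real n + 1)) \<le> c * (real n + 1) - 1"
      using c by (intro ln_le_minus_one) simp
    then have "ln (real n + 1) \<le> c * (real n + 1) - 1 - ln c"
      using c by (simp add: ln_mult)
    then have "log 2 (real n + 1) \<le> (c * (real n + 1) - 1 - ln c) / ln 2"
      unfolding log_def by (intro divide_right_mono) auto
    also have "\<dots> = \<delta> * real n + (\<delta> - 1 / ln 2 - ln c / ln 2)"
      by (simp add: c_def diff_divide_distrib add_divide_distrib distrib_left)
    finally show ?thesis .
  qed
  then show "\<exists>C. \<forall>n. log 2 (real n + 1) \<le> \<delta> * real n + C" by blast
qed

section \<open>Hausdorff dimension in the space of binary sequences\<close>

lemma prefix_eq_iff: "prefix n x = prefix n y \<longleftrightarrow> (\<forall>k<n. x k = y k)"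
  by (auto simp: subsequence_def)

lemma suffix_eq_shift: "(shift ^^ n) \<omega> = suffix n \<omega>"
  by (induction n) (auto simp: shift_def suffix_def)

lemma dist_omega_le:
  assumes "prefix n x = prefix n y"
  shows "dist_omega x y \<le> (1 / 2) ^ n"
proof -
  have eq: "x k = y k" if "k < n" for k using assms that by (simp add: prefix_eq_iff)
  have "dist_omega x y = (\<Sum>k. \<bar>of_bool (x (k + n)) - of_bool (y (k + n))\<bar> * (1 / 2) ^ Suc (k + n))"
    unfolding dist_omega_def
    by (subst suminf_split_initial_segment[OF summable_dist_omega, of _ _ n]) (simp add: eq)
  also have "\<dots> \<le> (\<Sum>k. (1 / 2) ^ n * (1 / 2) ^ Suc k)"
  proof (intro suminf_le)
    show "summable (\<lambda>k. \<bar>of_bool (x (k + n)) - of_bool (y (k + n))\<bar> * (1 / 2 :: real) ^ Suc (k + n))"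
      using summable_ignore_initial_segment[OF summable_dist_omega] .
    show "summable (\<lambda>k. (1 / 2 :: real) ^ n * (1 / 2) ^ Suc k)"
      using summable_geometric[of "1 / 2 :: real"] by (intro summable_mult) (subst summable_Suc_iff, simp)
  qed (auto simp: power_add of_bool_def)
  also have "\<dots> = (1 / 2) ^ n"
    using sums_mult[OF power_half_series, of "(1 / 2) ^ n"] by (simp add: sums_iff)
  finally show ?thesis .
qed

lemma dist_omega_ge:
  assumes "x k \<noteq> y k"
  shows "(1 / 2) ^ Suc k \<le> dist_omega x y"
proof -
  have "(\<Sum>j\<in>{k}. \<bar>of_bool (x j) - of_bool (y j)\<bar> * (1 / 2 :: real) ^ Suc j) \<le> dist_omega x y"
    unfolding dist_omega_def by (intro sum_le_suminf summable_dist_omega) auto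
  then show ?thesis using assms by (auto simp: of_bool_def split: if_splits)
qed

lemma prefix_eq_if_dist_omega:
  assumes "dist_omega x y < (1 / 2) ^ n"
  shows "prefix n x = prefix n y"
proof (rule ccontr)
  assume "\<not> ?thesis"
  then obtain k where k: "k < n" "x k \<noteq> y k" by (auto simp: prefix_eq_iff)
  have "(1 / 2 :: real) ^ n \<le> (1 / 2) ^ Suc k" using k by (intro power_decreasing) auto
  then show False using dist_omega_ge[of x k y] k assms by simp
qed

lemma dist_omega_le_1: "dist_omega x y \<le> 1"
  using dist_omega_le[where n = 0 and x = x and y = y] by simp

lemma ediam_le:
  assumes "\<And>x y. x \<in> U \<Longrightarrow> y \<in> U \<Longrightarrow> d x y \<le> r"
  shows "ediam d U \<le> ennreal r"
  unfolding ediam_def by (intro SUP_least ennreal_leI assms)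

lemma dist_le_ediam:
  assumes "x \<in> U" "y \<in> U"
  shows "ennreal (d x y) \<le> ediam d U"
  unfolding ediam_def using assms by (blast intro: SUP_upper2 order_refl)

lemma ediam_omega_le_1: "ediam dist_omega U \<le> 1"
  using ediam_le[of U dist_omega 1] dist_omega_le_1 by simp

lemma ediam_cylinder: "ediam dist_omega {x. prefix n x = w} \<le> ennreal ((1 / 2) ^ n)"
  by (intro ediam_le dist_omega_le) auto

lemma diam_powr_le:
  assumes "ediam d U \<le> ennreal r" "r > 0" "t \<ge> 0"
  shows "diam_powr d t U \<le> ennreal (r powr t)"
proof -
  have "enn2real (ediam d U) \<le> r"
    using assms(1,2) enn2real_mono[of "ediam d U" "ennreal r"] by simp
  then show ?thesis
    using assms unfolding diam_powr_def by (auto intro!: ennreal_leI powr_mono2)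
qed

lemma hausdorff_measure_eq_0I:
  assumes "\<And>\<delta> \<epsilon>. \<delta> > 0 \<Longrightarrow> \<epsilon> > 0 \<Longrightarrow> \<exists>U :: nat \<Rightarrow> _. A \<subseteq> (\<Union>i. U i) \<and>
    (\<forall>i. ediam d (U i) \<le> ennreal \<delta>) \<and> (\<Sum>i. diam_powr d s (U i)) \<le> ennreal \<epsilon>"
  shows "hausdorff_measure d s A = 0"
proof -
  have "hausdorff_premeasure d s \<delta> A \<le> 0" if "\<delta> > 0" for \<delta>
  proof (rule ennreal_le_epsilon)
    fix \<epsilon> :: real assume "\<epsilon> > 0"
    then obtain U :: "nat \<Rightarrow> _" where U: "A \<subseteq> (\<Union>i. U i)" "\<forall>i. ediam d (U i) \<le> ennreal \<delta>"
      "(\<Sum>i. diam_powr d s (U i)) \<le> ennreal \<epsilon>"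
      using assms[OF \<open>\<delta> > 0\<close>] by blast
    have "hausdorff_premeasure d s \<delta> A \<le> (\<Sum>i. diam_powr d s (U i))"
      unfolding hausdorff_premeasure_def using U by (intro INF_lower) auto
    then show "hausdorff_premeasure d s \<delta> A \<le> 0 + ennreal \<epsilon>" using U by simp
  qed
  then show ?thesis unfolding hausdorff_measure_def by (auto intro!: antisym SUP_least)
qed

lemma hausdorff_dim_le:
  assumes "t \<ge> 0" "\<And>s. s > t \<Longrightarrow> hausdorff_measure d s A = 0"
  shows "hausdorff_dim d A \<le> ennreal t"
proof (rule ennreal_le_epsilon)
  fix \<epsilon> :: real assume "\<epsilon> > 0"
  then have "hausdorff_dim d A \<le> ennreal (t + \<epsilon>)"
    unfolding hausdorff_dim_def using assms by (intro Inf_lower CollectI exI[of _ "t + \<epsilon>"]) auto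
  then show "hausdorff_dim d A \<le> ennreal t + ennreal \<epsilon>"
    using \<open>\<epsilon> > 0\<close> assms(1) by simp
qed

lemma finite_prefix_image [simp]: "finite (prefix n ` F)" for F :: "omega set"
proof (rule finite_subset)
  show "prefix n ` F \<subseteq> {w. set w \<subseteq> UNIV \<and> length w = n}" by auto
qed (rule finite_lists_length_eq, simp)

text \<open>Each piece \<open>F M\<close> is covered by cylinders of its own length
  \<open>N M\<close> within a budget \<open>\<epsilon> / 2 ^ (M + 1)\<close>. Hence good counts
  along arbitrarily large lengths suffice, and no single length has to work for all pieces.\<close>

lemma hausdorff_measure_omega_eq_0:
  fixes F :: "nat \<Rightarrow> omega set"
  assumes A: "A \<subseteq> (\<Union>M. F M)" and t: "t > 0"
    and small: "\<And>M \<epsilon> n0. \<epsilon> > 0 \<Longrightarrow> \<exists>n\<ge>n0. real (card (prefix n ` F M)) * ((1 / 2) ^ n) powr t \<le> \<epsilon>"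
  shows "hausdorff_measure dist_omega t A = 0"
proof (rule hausdorff_measure_eq_0I)
  fix \<delta> \<epsilon> :: real assume d: "\<delta> > 0" and e: "\<epsilon> > 0"
  obtain n0 where n0: "(1 / 2 :: real) ^ n0 < \<delta>" using real_arch_pow_inv[OF d, of "1 / 2"] by auto
  have "\<exists>n\<ge>n0. real (card (prefix n ` F M)) * ((1 / 2) ^ n) powr t \<le> \<epsilon> * (1 / 2) ^ Suc M" for M
    using e by (intro small) simp
  then obtain N where N: "\<And>M. N M \<ge> n0"
    "\<And>M. real (card (prefix (N M) ` F M)) * ((1 / 2) ^ N M) powr t \<le> \<epsilon> * (1 / 2) ^ Suc M"
    by metis
  define K where "K M = card (prefix (N M) ` F M)" for M
  have "\<exists>h. bij_betw h {..<K M} (prefix (N M) ` F M)" for M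
    using ex_bij_betw_nat_finite[OF finite_prefix_image] by (simp add: K_def atLeast0LessThan)
  then obtain h where h: "\<And>M. bij_betw (h M) {..<K M} (prefix (N M) ` F M)" by metis
  \<comment> \<open>The pairs \<open>(M, j)\<close> are enumerated by \<open>prod_decode\<close>.
    Indices beyond \<open>K M\<close> are filled with the empty set, whose \<open>diam_powr\<close>
    is 0 even for exponent 0.\<close>
  define U where "U = (\<lambda>(M, j). if j < K M then {x :: omega. prefix (N M) x = h M j} else {})"
  show "\<exists>U :: nat \<Rightarrow> _. A \<subseteq> (\<Union>i. U i) \<and>
    (\<forall>i. ediam dist_omega (U i) \<le> ennreal \<delta>) \<and> (\<Sum>i. diam_powr dist_omega t (U i)) \<le> ennreal \<epsilon>"
  proof (intro exI conjI allI)
    show "A \<subseteq> (\<Union>i. U (prod_decode i))"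
    proof
      fix x assume "x \<in> A"
      then obtain M where M: "x \<in> F M" using A by auto
      then obtain j where "j < K M" "h M j = prefix (N M) x"
        using h[of M] by (auto simp: bij_betw_def) (metis imageE imageI lessThan_iff)
      then have "x \<in> U (prod_decode (prod_encode (M, j)))" by (simp add: U_def)
      then show "x \<in> (\<Union>i. U (prod_decode i))" by blast
    qed
    show "ediam dist_omega (U (prod_decode i)) \<le> ennreal \<delta>" for i
    proof -
      obtain M j where Mj: "prod_decode i = (M, j)" by (cases "prod_decode i")
      have "ediam dist_omega (U (M, j)) \<le> ennreal ((1 / 2) ^ N M)"
        using ediam_cylinder[of "N M" "h M j"] by (auto simp: U_def ediam_def)
      also have "ennreal ((1 / 2) ^ N M) \<le> ennreal \<delta>" 
        using n0 power_decreasing[OF N(1)[of M], of "1 / 2 :: real"] by (intro ennreal_leI) linarith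
      finally show ?thesis using Mj by simp
    qed
    have "(\<Sum>i. diam_powr dist_omega t (U (prod_decode i))) = (\<Sum>M. \<Sum>j. diam_powr dist_omega t (U (M, j)))"
      by (intro suminf_ennreal_2dimen) simp
    also have "\<dots> \<le> (\<Sum>M. ennreal (\<epsilon> * (1 / 2) ^ Suc M))"
    proof (intro suminf_le)
      fix M
      have "(\<Sum>j. diam_powr dist_omega t (U (M, j))) = (\<Sum>j<K M. diam_powr dist_omega t (U (M, j)))"
        by (intro suminf_finite) (auto simp: U_def diam_powr_def)
      also have "\<dots> \<le> (\<Sum>j<K M. ennreal (((1 / 2) ^ N M) powr t))"
        by (intro sum_mono diam_powr_le) (use t ediam_cylinder in \<open>auto simp: U_def\<close>)
      also have "\<dots> = ennreal (real (K M) * ((1 / 2) ^ N M) powr t)"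
        by (simp add: ennreal_mult ennreal_of_nat_eq_real_of_nat)
      also have "\<dots> \<le> ennreal (\<epsilon> * (1 / 2) ^ Suc M)" using N(2)[of M] by (intro ennreal_leI) (simp add: K_def)
      finally show "(\<Sum>j. diam_powr dist_omega t (U (M, j))) \<le> ennreal (\<epsilon> * (1 / 2) ^ Suc M)" .
    qed auto
    also have "\<dots> = ennreal \<epsilon>"
    proof (rule suminf_ennreal_eq)
      show "(\<lambda>M. \<epsilon> * (1 / 2) ^ Suc M) sums \<epsilon>" using sums_mult[OF power_half_series, of \<epsilon>] by simp
    qed (use e in simp)
    finally show "(\<Sum>i. diam_powr dist_omega t (U (prod_decode i))) \<le> ennreal \<epsilon>" .
  qed
qed

text \<open>The mass distribution principle, for the image under \<open>g\<close> of a probability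
  measure on a parameter space. Measurable supersets \<open>B\<close> of the preimages of cylinders
  replace measurability of \<open>g\<close>.\<close>

lemma hausdorff_dim_omega_ge:
  fixes g :: "'a \<Rightarrow> omega"
  assumes M: "prob_space M" and g: "\<And>x. x \<in> space M \<Longrightarrow> g x \<in> A" and s: "s \<ge> 0" and C: "C > 0"
    and cyl: "\<And>n w. \<exists>B\<in>sets M. {x\<in>space M. prefix n (g x) = w} \<subseteq> B \<and>
      emeasure M B \<le> ennreal (C * ((1 / 2) ^ n) powr s)"
  shows "ennreal s \<le> hausdorff_dim dist_omega A"
  unfolding hausdorff_dim_def
proof (rule Inf_greatest, safe)
  interpret prob_space M by fact
  fix t assume t: "0 \<le> t" and null: "hausdorff_measure dist_omega t A = 0"
  have "\<forall>n. \<exists>b. \<forall>w. b w \<in> sets M \<and> {x\<in>space M. prefix n (g x) = w} \<subseteq> b w \<and>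
      emeasure M (b w) \<le> ennreal (C * ((1 / 2) ^ n) powr s)"
    by (intro allI choice) (use cyl in blast)
  then obtain B where B: "\<And>n w. B n w \<in> sets M" "\<And>n w. {x\<in>space M. prefix n (g x) = w} \<subseteq> B n w"
    "\<And>n w. emeasure M (B n w) \<le> ennreal (C * ((1 / 2) ^ n) powr s)"
    by (drule_tac choice) blast
  show "ennreal s \<le> ennreal t"
  proof (rule ccontr)
    assume "\<not> ?thesis"
    then have ts: "t < s" using t by (metis ennreal_leI not_le)
    \<comment> \<open>The factor \<open>2 powr t\<close> pays for replacing a set of diameter
      \<open>d\<close> by a cylinder of length \<open>n\<close> with
      \<open>(1 / 2) ^ n \<le> 2 * d\<close>.\<close>
    define D where "D = C * 2 powr t"
    have D: "D > 0" using C by (simp add: D_def)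
    have *: "\<exists>B'\<in>sets M. {x\<in>space M. g x \<in> U} \<subseteq> B' \<and> emeasure M B' \<le> ennreal D * diam_powr dist_omega t U"
      for U
    proof (cases "U = {}")
      case True
      then show ?thesis by (intro bexI[of _ "{}"]) auto
    next
      case False
      then obtain u where u: "u \<in> U" by blast
      define d where "d = enn2real (ediam dist_omega U)"
      have fin: "ediam dist_omega U < top" using ediam_omega_le_1[of U] by (simp add: order_le_less_trans)
      then have ed: "ediam dist_omega U = ennreal d" by (simp add: d_def)
      have d0: "d \<ge> 0" by (simp add: d_def)
      have d1: "d \<le> 1" using ediam_omega_le_1[of U] ed by simp
      have dist: "dist_omega x y \<le> d" if "x \<in> U" "y \<in> U" for x y
        using dist_le_ediam[OF that, of dist_omega] ed d0 by simp
      show ?thesis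
      proof (cases "d = 0")
        \<comment> \<open>A set of diameter 0 is a single point. It may contribute 0 to the sum, so
          its preimage must be null; this holds because \<open>s > t \<ge> 0\<close> forces the
          masses of the cylinders around it to tend to 0.\<close>
        case True
        have "{x\<in>space M. g x \<in> U} \<subseteq> (\<Inter>n. B n (prefix n u))"
        proof safe
          fix x n assume x: "x \<in> space M" "g x \<in> U"
          have "dist_omega (g x) u < (1 / 2) ^ n" using dist[OF x(2) u] True by (auto intro: le_less_trans)
          then have "prefix n (g x) = prefix n u" by (rule prefix_eq_if_dist_omega)
          then show "x \<in> B n (prefix n u)" using B(2)[of n "prefix n u"] x by auto
        qed
        moreover have "emeasure M (\<Inter>n. B n (prefix n u)) = 0"
        proof -
          have "emeasure M (\<Inter>n. B n (prefix n u)) \<le> ennreal (C * ((1 / 2) ^ n) powr s)" for n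
            using B by (meson INF_lower2 UNIV_I emeasure_mono order_refl order_trans)
          moreover have "(\<lambda>n. ennreal (C * ((1 / 2) ^ n) powr s)) \<longlonglongrightarrow> ennreal (C * 0)"
          proof (intro tendsto_ennrealI tendsto_mult tendsto_const)
            have "((1 / 2 :: real) ^ n) powr s = ((1 / 2) powr s) ^ n" for n
              by (simp add: powr_power powr_realpow[symmetric] powr_powr mult.commute)
            moreover have "(1 / 2 :: real) powr s < 1" using ts t powr_less_mono2[of s "1 / 2" 1] by simp
            ultimately show "(\<lambda>n. ((1 / 2 :: real) ^ n) powr s) \<longlonglongrightarrow> 0"
              by (simp add: LIMSEQ_realpow_zero)
          qed
          ultimately have "emeasure M (\<Inter>n. B n (prefix n u)) \<le> ennreal (C * 0)"
            by (intro LIMSEQ_le_const) auto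
          then show ?thesis by simp
        qed
        ultimately show ?thesis using B(1) by (intro bexI[of _ "\<Inter>n. B n (prefix n u)"]) auto
      next
        case False
        with d0 have d: "d > 0" by simp
        \<comment> \<open>By minimality \<open>d < (1 / 2) ^ n\<close> unless \<open>n = 0\<close>,
          so \<open>U\<close> lies in one cylinder of length \<open>n\<close>. The case
          \<open>n = 0\<close> is separate because \<open>d = 1\<close> can occur; there the
          cylinder is the whole space.\<close>
        define n where "n = (LEAST n. (1 / 2) ^ Suc n \<le> d)"
        have "\<exists>n. (1 / 2 :: real) ^ Suc n \<le> d"
        proof -
          obtain n where "(1 / 2 :: real) ^ n < d" using real_arch_pow_inv[OF d, of "1 / 2"] by auto
          moreover have "(1 / 2 :: real) ^ Suc n \<le> (1 / 2) ^ n" by simp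
          ultimately show ?thesis by (meson less_imp_le order_trans)
        qed
        then have n: "(1 / 2) ^ Suc n \<le> d" unfolding n_def by (rule LeastI_ex)
        have n': "n = 0 \<or> d < (1 / 2) ^ n"
        proof (cases n)
          case (Suc j)
          then have "j < (LEAST n. (1 / 2) ^ Suc n \<le> d)" using n_def by linarith
          then have "\<not> (1 / 2) ^ Suc j \<le> d" by (rule not_less_Least)
          then show ?thesis using Suc by simp
        qed simp
        have "{x\<in>space M. g x \<in> U} \<subseteq> B n (prefix n u)"
        proof safe
          fix x assume x: "x \<in> space M" "g x \<in> U"
          have "prefix n (g x) = prefix n u"
          proof (cases "n = 0")
            case False
            then have "dist_omega (g x) u < (1 / 2) ^ n" using dist[OF x(2) u] n' by auto
            then show ?thesis by (rule prefix_eq_if_dist_omega)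
          qed simp
          then show "x \<in> B n (prefix n u)" using B(2)[of n "prefix n u"] x by auto
        qed
        moreover have "emeasure M (B n (prefix n u)) \<le> ennreal D * diam_powr dist_omega t U"
        proof -
          have "((1 / 2) ^ n) powr s \<le> ((1 / 2) ^ n) powr t"
            using ts by (intro powr_mono') (auto simp: power_le_one)
          also have "\<dots> = (2 * (1 / 2) ^ Suc n) powr t" by simp
          also have "\<dots> = 2 powr t * ((1 / 2) ^ Suc n) powr t" by (rule powr_mult)
          also have "\<dots> \<le> 2 powr t * d powr t" using n t by (intro mult_left_mono powr_mono2) auto
          finally have "C * ((1 / 2) ^ n) powr s \<le> D * d powr t"
            using C by (simp add: D_def mult.assoc)
          then have "emeasure M (B n (prefix n u)) \<le> ennreal (D * d powr t)"
            using B(3)[of n "prefix n u"] by (meson ennreal_leI order_trans)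
          also have "\<dots> = ennreal D * diam_powr dist_omega t U"
            using \<open>U \<noteq> {}\<close> D d by (auto simp: diam_powr_def ennreal_mult d_def)
          finally show ?thesis .
        qed
        ultimately show ?thesis using B(1) by blast
      qed
    qed
    have "hausdorff_premeasure dist_omega t 1 A \<le> hausdorff_measure dist_omega t A"
      unfolding hausdorff_measure_def by (intro SUP_upper) auto
    then have "hausdorff_premeasure dist_omega t 1 A < ennreal (1 / D)" using null D by simp
    then obtain U :: "nat \<Rightarrow> omega set" where U: "A \<subseteq> (\<Union>i. U i)"
      "(\<Sum>i. diam_powr dist_omega t (U i)) < ennreal (1 / D)"
      unfolding hausdorff_premeasure_def INF_less_iff by auto
    have "\<forall>i. \<exists>b. b \<in> sets M \<and> {x\<in>space M. g x \<in> U i} \<subseteq> b \<and>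
      emeasure M b \<le> ennreal D * diam_powr dist_omega t (U i)"
      using * by blast
    then obtain B' where B': "\<And>i. B' i \<in> sets M" "\<And>i. {x\<in>space M. g x \<in> U i} \<subseteq> B' i"
      "\<And>i. emeasure M (B' i) \<le> ennreal D * diam_powr dist_omega t (U i)"
      by (drule_tac choice) blast
    have "1 = emeasure M (space M)" by (simp add: emeasure_space_1)
    also have "\<dots> \<le> emeasure M (\<Union>i. B' i)"
    proof (rule emeasure_mono)
      show "space M \<subseteq> (\<Union>i. B' i)"
      proof
        fix x assume x: "x \<in> space M"
        then obtain i where "g x \<in> U i" using g U(1) by blast
        then show "x \<in> (\<Union>i. B' i)" using B'(2)[of i] x by auto
      qed
    qed (use B' in auto)
    also have "\<dots> \<le> (\<Sum>i. emeasure M (B' i))" using B' by (intro emeasure_subadditive_countably) auto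
    also have "\<dots> \<le> (\<Sum>i. ennreal D * diam_powr dist_omega t (U i))" using B' by (intro suminf_le) auto
    also have "\<dots> = ennreal D * (\<Sum>i. diam_powr dist_omega t (U i))" by (rule ennreal_suminf_cmult)
    also have "\<dots> < ennreal D * ennreal (1 / D)" using U(2) D by (intro ennreal_mult_strict_left_mono) auto
    also have "\<dots> = 1" using D by (simp add: ennreal_mult[symmetric])
    finally show False by simp
  qed
qed

section \<open>Birkhoff spectra and growth rates of words\<close>

text \<open>The indices follow \<open>E_set\<close>: the term at 0 is absent, and the last term
  \<open>f (suffix n \<omega>)\<close> reads none of the first \<open>n\<close> letters.\<close>

definition bsum :: "(omega \<Rightarrow> real) \<Rightarrow> nat \<Rightarrow> omega \<Rightarrow> real" where
  "bsum f n \<omega> = (\<Sum>k=1..n. f (suffix k \<omega>))"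

lemma bsum_add: "bsum f (a + n) \<omega> = bsum f a \<omega> + bsum f n (suffix a \<omega>)"
  by (induction n) (simp_all add: bsum_def del: suffix_nth)

lemma E_set_iff: "\<omega> \<in> E_set f \<alpha> \<longleftrightarrow> (\<lambda>n. (bsum f n \<omega> - real n * \<alpha>) / real n) \<longlonglongrightarrow> 0"
proof -
  have "\<omega> \<in> E_set f \<alpha> \<longleftrightarrow> (\<lambda>n. bsum f n \<omega> / real n) \<longlonglongrightarrow> \<alpha>"
    by (simp add: E_set_def bsum_def suffix_eq_shift)
  also have "\<dots> \<longleftrightarrow> (\<lambda>n. bsum f n \<omega> / real n - \<alpha>) \<longlonglongrightarrow> 0"
    by (rule LIM_zero_iff[symmetric])
  also have "\<dots> \<longleftrightarrow> (\<lambda>n. (bsum f n \<omega> - real n * \<alpha>) / real n) \<longlonglongrightarrow> 0"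
    by (intro filterlim_cong refl eventually_mono[OF eventually_gt_at_top[of 0]])
       (simp add: field_simps)
  finally show ?thesis .
qed

section \<open>Concatenation of blocks of slowly growing length\<close>

definition tri :: "nat \<Rightarrow> nat" where
  "tri i = (\<Sum>j<i. j)"

lemma tri_Suc [simp]: "tri (Suc i) = tri i + i" and tri_0 [simp]: "tri 0 = 0"
  by (simp_all add: tri_def)

lemma real_tri: "real (tri i) = real i * (real i - 1) / 2"
  by (induction i) (auto simp: field_simps)

text \<open>The index of the block that contains position \<open>n\<close>. Block 0 is empty, so
  position 0 belongs to block 1.\<close>

definition tri_root :: "nat \<Rightarrow> nat" where
  "tri_root n = (LEAST i. n < tri (Suc i))"

lemma less_tri: "n < tri (Suc (tri_root n))"
proof -
  have "n < tri (Suc (Suc n))" by simp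
  then show ?thesis unfolding tri_root_def by (rule LeastI)
qed

lemma tri_le: "tri (tri_root n) \<le> n"
proof (cases "tri_root n")
  case (Suc j)
  then have "\<not> n < tri (Suc j)" unfolding tri_root_def by (intro not_less_Least) simp
  then show ?thesis using Suc by simp
qed simp

lemma sublin_tri_root: "sublin (\<lambda>n. real (tri_root n))"
proof (rule sublinI)
  fix \<delta> :: real assume d: "\<delta> > 0"
  have "real (tri_root n) \<le> \<delta> * real n + (1 + 2 / \<delta>)" for n
  proof (cases "real (tri_root n) \<le> 1 + 2 / \<delta>")
    case False
    let ?i = "real (tri_root n)"
    have "2 \<le> \<delta> * (?i - 1)" using False d by (simp add: field_simps)
    then have "?i * 2 \<le> ?i * (\<delta> * (?i - 1))" by (intro mult_left_mono) auto
    then have "?i \<le> \<delta> * real (tri (tri_root n))" by (simp add: real_tri field_simps)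
    also have "\<dots> \<le> \<delta> * real n" using d tri_le[of n] by simp
    finally show ?thesis using d by (smt (verit) divide_pos_pos)
  qed (use d in \<open>simp add: add_increasing\<close>)
  then show "\<exists>C. \<forall>n. real (tri_root n) \<le> \<delta> * real n + C" by blast
qed

text \<open>The linear parts of the errors add up to a small multiple of the total length
  \<open>tri (tri_root n) \<le> n\<close>, and the constant parts are multiplied by the number of
  blocks, which is itself o(n).\<close>

lemma sublin_sum_tri_root:
  assumes v: "sublin v"
  shows "sublin (\<lambda>n. \<Sum>j<tri_root n. v j)"
proof (rule sublinI)
  fix \<delta> :: real assume "\<delta> > 0"
  then have d: "\<delta> / 2 > 0" by simp
  obtain C where C: "C \<ge> 0" "\<And>n. v n \<le> \<delta> / 2 * real n + C" using sublinE[OF v d] by metis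
  have "\<delta> / 2 / (C + 1) > 0" using d C(1) by simp
  then obtain D where D: "\<And>n. real (tri_root n) \<le> \<delta> / 2 / (C + 1) * real n + D"
    using sublinE[OF sublin_tri_root] by metis
  have "(\<Sum>j<tri_root n. v j) \<le> \<delta> * real n + (C + 1) * D" for n
  proof -
    have "(\<Sum>j<tri_root n. v j) \<le> (\<Sum>j<tri_root n. \<delta> / 2 * real j + C)"
      by (intro sum_mono C)
    also have "\<dots> = \<delta> / 2 * real (tri (tri_root n)) + C * real (tri_root n)"
      by (simp add: sum.distrib tri_def sum_distrib_left)
    also have "\<dots> \<le> \<delta> / 2 * real n + (C + 1) * real (tri_root n)"
      using d C(1) tri_le[of n] by (intro add_mono mult_left_mono mult_right_mono) auto
    also have "(C + 1) * real (tri_root n) \<le> (C + 1) * (\<delta> / 2 / (C + 1) * real n + D)"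
      using C(1) D by (intro mult_left_mono) auto
    also have "\<dots> = \<delta> / 2 * real n + (C + 1) * D"
      using C(1) by (simp add: field_simps)
    finally show ?thesis by simp
  qed
  then show "\<exists>C. \<forall>n. (\<Sum>j<tri_root n. v j) \<le> \<delta> * real n + C" by blast
qed

text \<open>The concatenation \<open>x 0 x 1 x 2 \<dots>\<close>, meant for blocks with \<open>length (x i) = i\<close>, so that block
  \<open>i\<close> starts at position \<open>tri i\<close>. Block lengths tend to infinity but are negligible compared with
  the position, as the Moran construction needs.\<close>

definition join_blocks :: "(nat \<Rightarrow> bool list) \<Rightarrow> omega" where
  "join_blocks x k = concat (map x [0..<k + 2]) ! k"

context
  fixes x :: "nat \<Rightarrow> bool list"
  assumes len: "\<And>i. length (x i) = i"
begin

lemma length_concat_blocks: "length (concat (map x [0..<i])) = tri i"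
  by (induction i) (auto simp: len)

lemma concat_blocks_nth:
  assumes "k < tri i" "i \<le> j"
  shows "concat (map x [0..<j]) ! k = concat (map x [0..<i]) ! k"
  using assms(2)
proof (induction j rule: dec_induct)
  case (step m)
  have "k < length (concat (map x [0..<i]))" using assms(1) by (simp add: length_concat_blocks)
  moreover have "length (concat (map x [0..<i])) \<le> length (concat (map x [0..<m]))"
    unfolding length_concat_blocks using step by (simp add: tri_def sum_mono2)
  ultimately show ?case using step by (simp add: nth_append)
qed simp

lemma prefix_join_blocks: "prefix (tri i) (join_blocks x) = concat (map x [0..<i])"
proof (rule nth_equalityI)
  fix k assume "k < length (prefix (tri i) (join_blocks x))"
  then have k: "k < tri i" by simp
  \<comment> \<open>The first \<open>k + 2\<close> blocks, which are all that
    \<open>join_blocks\<close> reads for position \<open>k\<close>, do reach it.\<close>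
  have k': "k < tri (k + 2)" by simp
  show "prefix (tri i) (join_blocks x) ! k = concat (map x [0..<i]) ! k"
    using concat_blocks_nth[OF k, of "k + 2"] concat_blocks_nth[OF k', of i] k
    by (cases "i \<le> k + 2") (simp_all add: join_blocks_def)
qed (simp add: length_concat_blocks)

lemma suffix_join_blocks: "suffix (tri i) (join_blocks x) = x i \<frown> suffix (tri (Suc i)) (join_blocks x)"
proof -
  have "join_blocks x = prefix (tri (Suc i)) (join_blocks x) \<frown> suffix (tri (Suc i)) (join_blocks x)"
    by simp
  also have "\<dots> = concat (map x [0..<i]) \<frown> (x i \<frown> suffix (tri (Suc i)) (join_blocks x))"
    unfolding prefix_join_blocks by simp
  finally have "suffix (tri i) (join_blocks x) = suffix (tri i) \<dots>" by simp
  also have "\<dots> = x i \<frown> suffix (tri (Suc i)) (join_blocks x)"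
    by (metis length_concat_blocks suffix_conc_length)
  finally show ?thesis .
qed

lemma bsum_join_blocks: "bsum f (tri i) (join_blocks x) =
    (\<Sum>j<i. bsum f j (x j \<frown> suffix (tri (Suc j)) (join_blocks x)))"
proof (induction i)
  case (Suc i)
  then show ?case unfolding tri_Suc[of i] bsum_add by (simp add: suffix_join_blocks del: suffix_nth)
qed (simp add: bsum_def)

text \<open>Complete blocks can be read off a prefix. In the Moran construction this turns a
  cylinder into separate conditions on the independent coordinates \<open>x j\<close>.\<close>

lemma block_join_blocks:
  assumes "tri (Suc j) \<le> n"
  shows "x j = take j (drop (tri j) (prefix n (join_blocks x)))"
proof -
  have "take j (drop (tri j) (prefix n (join_blocks x)))
      = drop (tri j) (prefix (tri (Suc j)) (join_blocks x))"
    using assms by (simp add: take_drop add.commute min_absorb1)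
  also have "\<dots> = drop (tri j) (concat (map x [0..<j]) @ x j)"
    unfolding prefix_join_blocks by simp
  also have "\<dots> = x j" using length_concat_blocks[of j] by simp
  finally show ?thesis by simp
qed

end

section \<open>Counting words with prescribed Birkhoff sums\<close>

locale birkhoff =
  fixes f :: "omega \<Rightarrow> real" and B :: real and V :: "nat \<Rightarrow> real"
  assumes bound: "\<And>\<omega>. \<bar>f \<omega>\<bar> \<le> B"
    and var: "\<And>n x y. prefix n x = prefix n y \<Longrightarrow> \<bar>bsum f n x - bsum f n y\<bar> \<le> V n"
    and sublin_V: "sublin V"
begin

lemma abs_bsum_le: "\<bar>bsum f n \<omega>\<bar> \<le> real n * B"
proof -
  have "\<bar>bsum f n \<omega>\<bar> \<le> (\<Sum>k=1..n. \<bar>f (suffix k \<omega>)\<bar>)" unfolding bsum_def by (rule sum_abs)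
  also have "\<dots> \<le> (\<Sum>k=1..n. B)" by (intro sum_mono bound)
  finally show ?thesis by simp
qed

lemma V_nonneg: "V n \<ge> 0"
  using var[where n = n and x = undefined and y = undefined] by simp

text \<open>The centre \<open>c\<close> is a value of the sum, not of the average, so that centres
  add under concatenation. One good continuation \<open>x\<close> is enough, since any other one
  changes the sum by at most \<open>V n\<close>.\<close>

definition level_words :: "nat \<Rightarrow> real \<Rightarrow> real \<Rightarrow> bool list set" where
  "level_words n c r = {w. length w = n \<and> (\<exists>x. \<bar>bsum f n (w \<frown> x) - c\<bar> \<le> r)}"

lemma finite_level_words [simp]: "finite (level_words n c r)"
proof (rule finite_subset)
  show "level_words n c r \<subseteq> {w. set w \<subseteq> UNIV \<and> length w = n}" by (auto simp: level_words_def)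
qed (rule finite_lists_length_eq, simp)

lemma level_words_mono:
  assumes "\<bar>c - c'\<bar> + r \<le> r'"
  shows "level_words n c r \<subseteq> level_words n c' r'"
proof -
  have "\<bar>b - c'\<bar> \<le> r'" if "\<bar>b - c\<bar> \<le> r" for b using assms that by linarith
  then show ?thesis unfolding level_words_def by blast
qed

lemma card_level_words_mono: "\<bar>c - c'\<bar> + r \<le> r' \<Longrightarrow> card (level_words n c r) \<le> card (level_words n c' r')"
  by (intro card_mono level_words_mono) auto

lemma prefix_in_level_words: "\<bar>bsum f n \<omega> - c\<bar> \<le> r \<Longrightarrow> prefix n \<omega> \<in> level_words n c r"
  unfolding level_words_def by (auto intro!: exI[of _ "suffix n \<omega>"])

lemma level_words_bsum: "w \<in> level_words n c r \<Longrightarrow> \<bar>bsum f n (w \<frown> x) - c\<bar> \<le> r + V n"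
proof -
  assume "w \<in> level_words n c r"
  then obtain y where w: "length w = n" "\<bar>bsum f n (w \<frown> y) - c\<bar> \<le> r" by (auto simp: level_words_def)
  then have "\<bar>bsum f n (w \<frown> x) - bsum f n (w \<frown> y)\<bar> \<le> V n" by (intro var) simp
  then show ?thesis using w(2) by linarith
qed

lemma card_level_words_eq:
  assumes "real n * B + \<bar>c\<bar> \<le> r"
  shows "card (level_words n c r) = 2 ^ n"
proof -
  have "level_words n c r = {w. set w \<subseteq> UNIV \<and> length w = n}"
  proof -
    have "\<bar>bsum f n \<omega> - c\<bar> \<le> r" for \<omega> using assms abs_bsum_le[of n \<omega>] by linarith
    then show ?thesis unfolding level_words_def by auto
  qed
  then show ?thesis using card_lists_length_eq[of "UNIV :: bool set" n] by simp
qed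

text \<open>Concatenation is injective for fixed lengths. The second word keeps its own
  continuation; only the first one is continued differently than in its witness, which costs
  \<open>V a\<close>.\<close>

lemma card_level_words_mult: "card (level_words a c r) * card (level_words b c' r') \<le> card (level_words (a + b) (c + c') (r + r' + V a))"
proof -
  have "inj_on (\<lambda>(u, v). u @ v) (level_words a c r \<times> level_words b c' r')"
    by (auto simp: inj_on_def level_words_def)
  moreover have "(\<lambda>(u, v). u @ v) ` (level_words a c r \<times> level_words b c' r') \<subseteq> level_words (a + b) (c + c') (r + r' + V a)"
  proof safe
    fix u v assume u: "u \<in> level_words a c r" and v: "v \<in> level_words b c' r'"
    then obtain x where x: "\<bar>bsum f b (v \<frown> x) - c'\<bar> \<le> r'" by (auto simp: level_words_def)
    have lu: "length u = a" and lv: "length v = b" using u v by (auto simp: level_words_def)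
    have "bsum f (a + b) ((u @ v) \<frown> x) = bsum f a (u \<frown> (v \<frown> x)) + bsum f b (v \<frown> x)"
      unfolding bsum_add using lu by (auto simp: conc_conc[symmetric] simp del: conc_conc)
    then have "\<bar>bsum f (a + b) ((u @ v) \<frown> x) - (c + c')\<bar> \<le> r + r' + V a"
      using level_words_bsum[OF u, of "v \<frown> x"] x by (simp add: abs_le_iff)
    then show "u @ v \<in> level_words (a + b) (c + c') (r + r' + V a)"
      unfolding level_words_def using lu lv by auto
  qed
  ultimately have "card (level_words a c r \<times> level_words b c' r') \<le> card (level_words (a + b) (c + c') (r + r' + V a))"
    by (intro card_inj_on_le) auto
  then show ?thesis by simp
qed

text \<open>At least \<open>2 powr (n * s - o(n))\<close> words of length \<open>n\<close> have average within \<open>o(1)\<close> of \<open>\<alpha>\<close>.\<close>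

definition growth_ge :: "real \<Rightarrow> real \<Rightarrow> bool" where
  "growth_ge \<alpha> s \<longleftrightarrow> (\<exists>u. sublin u \<and> (\<forall>n. 2 powr (real n * s - u n) \<le> real (card (level_words n (real n * \<alpha>) (u n)))))"

lemma growth_ge_mono: "growth_ge \<alpha> s \<Longrightarrow> t \<le> s \<Longrightarrow> growth_ge \<alpha> t"
  unfolding growth_ge_def
proof (elim exE conjE, intro exI conjI allI)
  fix u n assume "t \<le> s" and u: "\<forall>n. 2 powr (real n * s - u n) \<le> real (card (level_words n (real n * \<alpha>) (u n)))"
  then have "2 powr (real n * t - u n) \<le> 2 powr (real n * s - u n)" by (intro powr_mono) (auto intro: mult_left_mono)
  then show "2 powr (real n * t - u n) \<le> real (card (level_words n (real n * \<alpha>) (u n)))"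
    using u by (meson order_trans)
qed

text \<open>Words of length about \<open>p * n\<close> for \<beta> are followed by words of the
  remaining length for \<gamma>. Rounding \<open>p * n\<close> moves the target and the exponent by
  at most \<open>\<bar>\<beta> - \<gamma>\<bar>\<close> and
  \<open>\<bar>s - t\<bar>\<close>.\<close>

lemma growth_ge_convex:
  assumes "growth_ge \<beta> s" "growth_ge \<gamma> t" and p: "0 \<le> p" "p \<le> 1"
  shows "growth_ge (p * \<beta> + (1 - p) * \<gamma>) (p * s + (1 - p) * t)"
proof -
  obtain u where u: "sublin u" "\<And>n. 2 powr (real n * s - u n) \<le> real (card (level_words n (real n * \<beta>) (u n)))"
    using assms(1) by (auto simp: growth_ge_def)
  obtain v where v: "sublin v" "\<And>n. 2 powr (real n * t - v n) \<le> real (card (level_words n (real n * \<gamma>) (v n)))"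
    using assms(2) by (auto simp: growth_ge_def)
  define a where "a n = nat \<lfloor>p * real n\<rfloor>" for n
  define w where "w n = u (a n) + v (n - a n) + V (a n) + (\<bar>\<beta> - \<gamma>\<bar> + \<bar>s - t\<bar>)" for n
  have an: "a n \<le> n" for n
  proof -
    have "p * real n \<le> real n" using p by (simp add: mult_left_le_one_le)
    then have "\<lfloor>p * real n\<rfloor> \<le> int n" by linarith
    then show ?thesis by (simp add: a_def)
  qed
  have dev: "\<bar>p * real n - real (a n)\<bar> \<le> 1" for n
    using p by (simp add: a_def) linarith
  have "sublin w"
    unfolding w_def by (intro sublin_add sublin_const sublin_compose[OF u(1)] sublin_compose[OF v(1)]
      sublin_compose[OF sublin_V] an) auto
  moreover have "2 powr (real n * (p * s + (1 - p) * t) - w n)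
      \<le> real (card (level_words n (real n * (p * \<beta> + (1 - p) * \<gamma>)) (w n)))" for n
  proof -
    have cut: "\<bar>(real (a n) * y + real (n - a n) * z) - real n * (p * y + (1 - p) * z)\<bar> \<le> \<bar>y - z\<bar>" for y z
    proof -
      have "(real (a n) * y + real (n - a n) * z) - real n * (p * y + (1 - p) * z)
          = (real (a n) - p * real n) * (y - z)"
        using an[of n] by (simp add: of_nat_diff algebra_simps)
      then show ?thesis using mult_right_mono[OF dev[of n], of "\<bar>y - z\<bar>"]
        by (simp add: abs_mult abs_minus_commute)
    qed
    have "2 powr (real n * (p * s + (1 - p) * t) - w n)
        \<le> 2 powr ((real (a n) * s - u (a n)) + (real (n - a n) * t - v (n - a n)))"
      using cut[of s t] V_nonneg[of "a n"] by (intro powr_mono) (auto simp: w_def)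
    also have "\<dots> \<le> real (card (level_words (a n) (real (a n) * \<beta>) (u (a n))))
        * real (card (level_words (n - a n) (real (n - a n) * \<gamma>) (v (n - a n))))"
      unfolding powr_add by (intro mult_mono u v) auto
    also have "\<dots> \<le> real (card (level_words (a n + (n - a n)) (real (a n) * \<beta> + real (n - a n) * \<gamma>)
        (u (a n) + v (n - a n) + V (a n))))"
      using card_level_words_mult by (simp flip: of_nat_mult)
    also have "\<dots> = real (card (level_words n (real (a n) * \<beta> + real (n - a n) * \<gamma>)
        (u (a n) + v (n - a n) + V (a n))))" using an[of n] by simp
    also have "\<dots> \<le> real (card (level_words n (real n * (p * \<beta> + (1 - p) * \<gamma>)) (w n)))"
      using cut[of \<beta> \<gamma>] by (intro of_nat_mono card_level_words_mono) (auto simp: w_def)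
    finally show ?thesis .
  qed
  ultimately show ?thesis unfolding growth_ge_def by blast
qed

text \<open>Every point of \<open>E_set f \<alpha>\<close> stays within tolerance \<delta> from some
  time \<open>M\<close> on, so the prefixes of the piece \<open>F M\<close> are level words for all
  \<open>n \<ge> M\<close>. Counting them at infinitely many lengths, for one fixed \<delta>, is
  enough.\<close>

lemma hausdorff_dim_E_le:
  assumes t: "t \<ge> 0" and d: "\<delta> > 0"
    and freq: "\<And>n0. \<exists>n\<ge>n0. real (card (level_words n (real n * \<alpha>) (real n * \<delta>))) \<le> 2 powr (real n * t)"
  shows "hausdorff_dim dist_omega (E_set f \<alpha>) \<le> ennreal t"
proof (rule hausdorff_dim_le[OF t])
  fix s assume s: "s > t"
  define F where "F M = {\<omega>. \<forall>n\<ge>M. \<bar>bsum f n \<omega> - real n * \<alpha>\<bar> \<le> real n * \<delta>}" for M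
  show "hausdorff_measure dist_omega s (E_set f \<alpha>) = 0"
  proof (rule hausdorff_measure_omega_eq_0)
    show "E_set f \<alpha> \<subseteq> (\<Union>M. F M)"
    proof
      fix \<omega> assume "\<omega> \<in> E_set f \<alpha>"
      from LIMSEQ_D[OF this[unfolded E_set_iff] d]
      obtain M where M: "\<And>n. n \<ge> M \<Longrightarrow> \<bar>(bsum f n \<omega> - real n * \<alpha>) / real n\<bar> < \<delta>"
        by auto
      have "\<bar>bsum f n \<omega> - real n * \<alpha>\<bar> \<le> real n * \<delta>" if "n \<ge> Suc M" for n
        using M[of n] that by (simp add: field_simps)
      then show "\<omega> \<in> (\<Union>M. F M)" unfolding F_def by blast
    qed
    fix M n0 :: nat and \<epsilon> :: real assume e: "\<epsilon> > 0"
    have "(1 / 2 :: real) powr (s - t) < 1" using s powr_less_mono2[of "s - t" "1 / 2" 1] by simp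
    then obtain n1 where n1: "((1 / 2 :: real) powr (s - t)) ^ n1 < \<epsilon>"
      using real_arch_pow_inv[OF e] by blast
    obtain n where n: "n \<ge> n0 + M + n1"
      "real (card (level_words n (real n * \<alpha>) (real n * \<delta>))) \<le> 2 powr (real n * t)"
      using freq by blast
    have "card (prefix n ` F M) \<le> card (level_words n (real n * \<alpha>) (real n * \<delta>))"
      using n(1) by (intro card_mono) (auto simp: F_def intro!: prefix_in_level_words)
    then have "real (card (prefix n ` F M)) * ((1 / 2) ^ n) powr s
        \<le> 2 powr (real n * t) * ((1 / 2) ^ n) powr s"
      using n(2) by (intro mult_right_mono) auto
    also have "\<dots> = ((1 / 2) powr (s - t)) ^ n"
    proof -
      have "((1 / 2 :: real) ^ n) powr s = 2 powr (- (real n * s))"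
        by (simp add: powr_minus powr_realpow[symmetric] powr_powr powr_divide power_divide inverse_eq_divide)
      moreover have "((1 / 2 :: real) powr (s - t)) ^ n = 2 powr (- (real n * (s - t)))"
        by (simp add: powr_minus powr_realpow[symmetric] powr_powr powr_divide power_divide
          inverse_eq_divide powr_power mult.commute)
      ultimately show ?thesis by (simp add: powr_add[symmetric] algebra_simps)
    qed
    also have "\<dots> \<le> ((1 / 2) powr (s - t)) ^ n1"
      using \<open>(1 / 2 :: real) powr (s - t) < 1\<close> n(1) by (intro power_decreasing) auto
    finally show "\<exists>n\<ge>n0. real (card (prefix n ` F M)) * ((1 / 2) ^ n) powr s \<le> \<epsilon>"
      using n(1) n1 by (intro exI[of _ n]) auto
  qed (use s t in simp)
qed

text \<open>The contrapositive of \<open>hausdorff_dim_E_le\<close> gives many words at every large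
  length for each fixed tolerance; the tolerances are then merged into one error function. With
  \<open>hausdorff_dim_E_ge\<close> this identifies dimension and growth rate, the source of
  concavity.\<close>

lemma growth_ge_of_hausdorff_dim:
  assumes s: "s > 0" and dim: "ennreal s \<le> hausdorff_dim dist_omega (E_set f \<alpha>)"
  shows "growth_ge \<alpha> s"
proof -
  have small: "\<exists>n0. \<forall>n\<ge>n0. 2 powr (real n * (s - \<delta>)) \<le> real (card (level_words n (real n * \<alpha>) (real n * \<delta>)))"
    if d: "0 < \<delta>" "\<delta> < s" for \<delta>
  proof (rule ccontr)
    assume "\<not> ?thesis"
    then have "hausdorff_dim dist_omega (E_set f \<alpha>) \<le> ennreal (s - \<delta>)"
      using d by (intro hausdorff_dim_E_le[of _ \<delta>]) (auto simp: not_le intro: less_imp_le)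
    with dim have "ennreal s \<le> ennreal (s - \<delta>)" by (rule order_trans)
    then show False using d by (simp add: ennreal_le_iff)
  qed
  have ev: "\<exists>n0. \<forall>n\<ge>n0. 2 powr (real n * s - real n * \<delta>) \<le> real (card (level_words n (real n * \<alpha>) (real n * \<delta>)))"
    if d: "0 < \<delta>" for \<delta>
  proof -
    \<comment> \<open>Keeps \<open>s - e\<close> positive, as a candidate for a dimension must be
      nonnegative.\<close>
    define e where "e = min \<delta> (s / 2)"
    have e: "0 < e" "e < s" "e \<le> \<delta>" using d s by (auto simp: e_def min_def)
    obtain n0 where n0: "\<And>n. n \<ge> n0 \<Longrightarrow>
        2 powr (real n * (s - e)) \<le> real (card (level_words n (real n * \<alpha>) (real n * e)))"
      using small[OF e(1,2)] by blast
    have "2 powr (real n * s - real n * \<delta>) \<le> real (card (level_words n (real n * \<alpha>) (real n * \<delta>)))" if "n \<ge> n0" for n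
    proof -
      have "real n * e \<le> real n * \<delta>" using e(3) by (rule mult_left_mono) simp
      then have "2 powr (real n * s - real n * \<delta>) \<le> 2 powr (real n * (s - e))"
        by (intro powr_mono) (auto simp: algebra_simps)
      also have "\<dots> \<le> real (card (level_words n (real n * \<alpha>) (real n * e)))" using that by (rule n0)
      also have "\<dots> \<le> real (card (level_words n (real n * \<alpha>) (real n * \<delta>)))"
        using \<open>real n * e \<le> real n * \<delta>\<close> by (intro of_nat_mono card_level_words_mono) simp
      finally show ?thesis .
    qed
    then show ?thesis by blast
  qed
  define P where "P n r \<longleftrightarrow> 2 powr (real n * s - r) \<le> real (card (level_words n (real n * \<alpha>) r))" for n r
  have P_mono: "P n r'" if "P n r" "r \<le> r'" for n r r'
  proof -
    have "2 powr (real n * s - r') \<le> 2 powr (real n * s - r)" using that by (intro powr_mono) auto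
    also have "\<dots> \<le> real (card (level_words n (real n * \<alpha>) r))" using that by (simp add: P_def)
    also have "\<dots> \<le> real (card (level_words n (real n * \<alpha>) r'))"
      using that by (intro of_nat_mono card_level_words_mono) simp
    finally show ?thesis by (simp add: P_def)
  qed
  \<comment> \<open>For a large enough error every word of length \<open>n\<close> is counted and
    the required number is at most 1.\<close>
  have ex: "\<exists>k. P n (real k)" for n
  proof -
    obtain k where k: "real k \<ge> (real n * B + \<bar>real n * \<alpha>\<bar>) + real n * s" using real_arch_simple by blast
    have "0 \<le> real n * B" using abs_bsum_le[of n undefined] by simp
    then have "2 powr (real n * s - real k) \<le> 2 powr 0" using k by (intro powr_mono) auto
    also have "\<dots> \<le> real (2 ^ n)" by simp
    also have "\<dots> = real (card (level_words n (real n * \<alpha>) (real k)))"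
      using k s by (subst card_level_words_eq) (auto intro: order_trans[rotated])
    finally show ?thesis unfolding P_def by blast
  qed
  \<comment> \<open>The smallest integer error that works lies below every
    \<open>\<lceil>n * \<delta>\<rceil>\<close> for large \<open>n\<close>, hence is o(n) without an
    explicit diagonal choice of tolerances.\<close>
  define u where "u n = (LEAST k. P n (real k))" for n
  have Pu: "P n (real (u n))" for n unfolding u_def using ex by (rule LeastI_ex)
  have u_le: "u n \<le> k" if "P n (real k)" for n k unfolding u_def using that by (rule Least_le)
  have "sublin (\<lambda>n. real (u n))"
  proof (rule sublinI)
    fix \<delta> :: real assume d: "\<delta> > 0"
    obtain n0 where n0: "\<And>n. n \<ge> n0 \<Longrightarrow> P n (real n * \<delta>)" using ev[OF d] unfolding P_def by blast
    have "real (u n) \<le> \<delta> * real n + (1 + (\<Sum>j<n0. real (u j)))" for n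
    proof (cases "n \<ge> n0")
      case True
      have "P n (real (nat \<lceil>real n * \<delta>\<rceil>))" by (rule P_mono[OF n0[OF True]]) (rule real_nat_ceiling_ge)
      then have "u n \<le> nat \<lceil>real n * \<delta>\<rceil>" by (rule u_le)
      then have "real (u n) \<le> real n * \<delta> + 1"
        using of_nat_ceiling[of "real n * \<delta>"] d by (smt (verit) ceiling_correct mult_nonneg_nonneg of_nat_0_le_iff of_nat_le_iff of_nat_nat zero_le_ceiling)
      moreover have "(\<Sum>j<n0. real (u j)) \<ge> 0" by (simp add: sum_nonneg)
      ultimately show ?thesis by (simp add: mult.commute)
    next
      case False
      then have "real (u n) \<le> (\<Sum>j<n0. real (u j))" by (intro member_le_sum) auto
      moreover have "\<delta> * real n \<ge> 0" using d by simp
      ultimately show ?thesis by linarith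
    qed
    then show "\<exists>C. \<forall>n. real (u n) \<le> \<delta> * real n + C" by blast
  qed
  then show ?thesis unfolding growth_ge_def using Pu by (auto simp: P_def)
qed

lemma join_blocks_in_E_set:
  assumes u: "sublin u" and x: "\<And>i. x i \<in> level_words i (real i * \<alpha>) (u i)"
  shows "join_blocks x \<in> E_set f \<alpha>"
  unfolding E_set_iff
proof (rule sublin_tendsto)
  let ?z = "join_blocks x"
  have len: "\<And>i. length (x i) = i" using x by (auto simp: level_words_def)
  \<comment> \<open>Bounds the deviation per letter in the unfinished last block. That block has at
    most \<open>i\<close> letters, so its error is charged as one \<open>c\<close> to each of the
    \<open>i\<close> finished blocks.\<close>
  define c where "c = B + \<bar>\<alpha>\<bar>"
  show "sublin (\<lambda>n. (\<Sum>j<tri_root n. u j + V j + c))"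
    by (intro sublin_sum_tri_root sublin_add u sublin_V sublin_const)
  fix n
  define i where "i = tri_root n"
  obtain m where m: "n = tri i + m" "m \<le> i"
    using tri_le[of n] less_tri[of n] that[of "n - tri i"] by (auto simp: i_def)
  have "\<bar>bsum f (tri i) ?z - real (tri i) * \<alpha>\<bar>
      = \<bar>\<Sum>j<i. bsum f j (x j \<frown> suffix (tri (Suc j)) ?z) - real j * \<alpha>\<bar>"
    unfolding bsum_join_blocks[of x, OF len] by (simp add: tri_def sum_subtractf sum_distrib_right)
  also have "\<dots> \<le> (\<Sum>j<i. u j + V j)"
    by (intro order_trans[OF sum_abs] sum_mono level_words_bsum x)
  finally have 1: "\<bar>bsum f (tri i) ?z - real (tri i) * \<alpha>\<bar> \<le> (\<Sum>j<i. u j + V j)" .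
  have "\<bar>bsum f m (suffix (tri i) ?z) - real m * \<alpha>\<bar> \<le> real m * B + real m * \<bar>\<alpha>\<bar>"
    using abs_bsum_le[of m "suffix (tri i) ?z"] abs_triangle_ineq4[of "bsum f m (suffix (tri i) ?z)" "real m * \<alpha>"]
    by (simp add: abs_mult)
  also have "\<dots> = real m * c" by (simp add: c_def distrib_left)
  also have "\<dots> \<le> real i * c"
    using m bound[of undefined] by (intro mult_right_mono) (auto simp: c_def)
  finally have "\<bar>bsum f n ?z - real n * \<alpha>\<bar> \<le> (\<Sum>j<i. u j + V j + c)"
    using 1 unfolding m(1) bsum_add by (simp add: sum.distrib algebra_simps abs_le_iff)
  then show "\<bar>bsum f n ?z - real n * \<alpha>\<bar> \<le> (\<Sum>j<tri_root n. u j + V j + c)"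
    by (simp add: i_def)
qed

text \<open>Moran construction: block \<open>j\<close> is drawn uniformly and independently from
  \<open>W j\<close>. A cylinder of length \<open>n\<close> fixes all finished blocks, so its mass
  is at most the product of the \<open>1 / card (W j)\<close>, which is
  \<open>2 powr (- n * s + o(n))\<close>.\<close>

lemma hausdorff_dim_E_ge:
  assumes s: "s \<ge> 0" and growth_ge: "growth_ge \<alpha> s"
  shows "ennreal s \<le> hausdorff_dim dist_omega (E_set f \<alpha>)"
proof -
  obtain u where u: "sublin u" "\<And>n. 2 powr (real n * s - u n) \<le> real (card (level_words n (real n * \<alpha>) (u n)))"
    using growth_ge by (auto simp: growth_ge_def)
  define W where "W i = level_words i (real i * \<alpha>) (u i)" for i
  have card_pos: "card (W i) > 0" for i
  proof -
    have "0 < 2 powr (real i * s - u i)" by simp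
    also have "\<dots> \<le> real (card (W i))" using u(2) by (simp add: W_def)
    finally show ?thesis by simp
  qed
  then have W: "W i \<noteq> {}" "finite (W i)" for i by (auto simp: W_def card_gt_0_iff)
  then have "\<exists>w0. \<forall>i. w0 i \<in> W i" by (intro choice) blast
  then obtain w0 where w0: "\<And>i. w0 i \<in> W i" by blast
  \<comment> \<open>The product measure lives on all sequences of lists, and
    \<open>x i \<in> W i\<close> holds only almost surely. The default \<open>w0 i\<close> makes
    every sample a valid sequence of blocks.\<close>
  define y where "y x i = (if x i \<in> W i then x i else w0 i)" for x :: "nat \<Rightarrow> bool list" and i
  have yW: "y x i \<in> W i" for x i using w0 by (simp add: y_def)
  then have len: "length (y x i) = i" for x i using yW[of x i] by (simp add: W_def level_words_def)
  define M where "M = PiM UNIV (\<lambda>i. measure_pmf (pmf_of_set (W i)))"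
  interpret M: product_prob_space "\<lambda>i. measure_pmf (pmf_of_set (W i))" UNIV ..
  have space_M: "space M = UNIV" by (simp add: M_def space_PiM)
  have *: "ennreal (s - \<delta>) \<le> hausdorff_dim dist_omega (E_set f \<alpha>)" if d: "0 < \<delta>" "\<delta> \<le> s" for \<delta>
  proof -
    \<comment> \<open>The extra \<open>s\<close> per finished block pays for the unfinished one,
      whose letters are not controlled by the cylinder.\<close>
    have "sublin (\<lambda>n. \<Sum>j<tri_root n. u j + s)"
      by (intro sublin_sum_tri_root sublin_add u sublin_const)
    then obtain C where C: "\<And>n. (\<Sum>j<tri_root n. u j + s) \<le> \<delta> * real n + C"
      using sublinE[OF _ d(1)] by metis
    show ?thesis
    proof (rule hausdorff_dim_omega_ge[where M = M and g = "\<lambda>x. join_blocks (y x)" and C = "2 powr C"])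
      show "prob_space M" unfolding M_def by (rule M.P.prob_space_axioms)
      show "join_blocks (y x) \<in> E_set f \<alpha>" for x
        using yW by (intro join_blocks_in_E_set[OF u(1)]) (simp add: W_def)
      fix n w
      define i where "i = tri_root n"
      \<comment> \<open>The values of coordinate \<open>j\<close> compatible with the cylinder of
        \<open>w\<close>; at most one of them lies in \<open>W j\<close>.\<close>
      define X where "X j = {v. (if v \<in> W j then v else w0 j) = take j (drop (tri j) w)}" for j
      define b where "b = {x\<in>space M. \<forall>j\<in>{..<i}. x j \<in> X j}"
      have b_sets: "b \<in> sets M"
        unfolding b_def M_def by (intro sets.sets_Collect_finite_All sets_Collect_single') auto
      have sub: "{x\<in>space M. prefix n (join_blocks (y x)) = w} \<subseteq> b"
      proof safe
        fix x assume "w = prefix n (join_blocks (y x))"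
        have "y x j = take j (drop (tri j) (prefix n (join_blocks (y x))))" if "j < i" for j
        proof (rule block_join_blocks[of "y x", OF len])
          have "tri (Suc j) \<le> tri i" unfolding tri_def using that by (intro sum_mono2) auto
          then show "tri (Suc j) \<le> n" using tri_le[of n] by (simp add: i_def)
        qed
        then show "x \<in> b"
          using \<open>w = _\<close> by (auto simp: b_def X_def y_def space_M)
      qed
      have "emeasure M b = (\<Prod>j<i. emeasure (measure_pmf (pmf_of_set (W j))) (X j))"
        unfolding b_def M_def by (intro M.emeasure_PiM_Collect) auto
      also have "\<dots> \<le> (\<Prod>j<i. ennreal (2 powr (u j - real j * s)))"
      proof (intro prod_mono_ennreal)
        fix j
        have "card (W j \<inter> X j) \<le> card {take j (drop (tri j) w)}"
          by (intro card_mono) (auto simp: X_def)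
        then have "real (card (W j \<inter> X j)) / real (card (W j)) \<le> 1 / real (card (W j))"
          by (intro divide_right_mono) auto
        also have "\<dots> \<le> 1 / 2 powr (real j * s - u j)"
          using u(2)[of j] card_pos[of j] by (intro divide_left_mono) (auto simp: W_def)
        also have "\<dots> = 2 powr (u j - real j * s)" by (simp add: powr_diff)
        finally show "emeasure (measure_pmf (pmf_of_set (W j))) (X j) \<le> ennreal (2 powr (u j - real j * s))"
          using W by (simp add: emeasure_pmf_of_set ennreal_leI divide_ennreal ennreal_of_nat_eq_real_of_nat card_pos)
      qed
      also have "\<dots> = ennreal (2 powr (\<Sum>j<i. u j - real j * s))"
        by (subst prod_ennreal) (auto simp: powr_sum)
      also have "(\<Sum>j<i. u j - real j * s) \<le> C + real n * (\<delta> - s)"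
      proof -
        have "(\<Sum>j<i. u j - real j * s) = (\<Sum>j<i. u j + s) - real (tri (Suc i)) * s"
          by (simp add: sum.distrib sum_subtractf tri_def sum_distrib_left algebra_simps)
        moreover have "real n * s \<le> real (tri (Suc i)) * s"
          using less_tri[of n] s unfolding i_def by (intro mult_right_mono) auto
        ultimately show ?thesis using C[of n] by (simp add: i_def algebra_simps)
      qed
      then have "ennreal (2 powr (\<Sum>j<i. u j - real j * s)) \<le> ennreal (2 powr (C + real n * (\<delta> - s)))"
        by (intro ennreal_leI powr_mono) auto
      also have "2 powr (C + real n * (\<delta> - s)) = 2 powr C * ((1 / 2) ^ n) powr (s - \<delta>)"
      proof -
        have "((1 / 2 :: real) ^ n) powr (s - \<delta>) = 2 powr (- (real n * (s - \<delta>)))"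
          by (simp add: powr_minus powr_realpow[symmetric] powr_powr powr_divide power_divide inverse_eq_divide)
        then show ?thesis by (simp add: powr_add[symmetric] algebra_simps)
      qed
      finally show "\<exists>b\<in>sets M. {x\<in>space M. prefix n (join_blocks (y x)) = w} \<subseteq> b \<and>
        emeasure M b \<le> ennreal (2 powr C * ((1 / 2) ^ n) powr (s - \<delta>))"
        using b_sets sub by (intro bexI[of _ b]) auto
    qed (use d in auto)
  qed
  show ?thesis
  proof (rule ennreal_le_epsilon)
    fix e :: real assume e: "e > 0"
    show "ennreal s \<le> hausdorff_dim dist_omega (E_set f \<alpha>) + ennreal e"
    proof (cases "s = 0")
      case False
      define \<delta> where "\<delta> = min e s"
      have d: "0 < \<delta>" "\<delta> \<le> s" "\<delta> \<le> e" using False s e by (auto simp: \<delta>_def)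
      have "ennreal s = ennreal (s - \<delta>) + ennreal \<delta>" using d by (simp add: ennreal_plus[symmetric])
      also have "\<dots> \<le> hausdorff_dim dist_omega (E_set f \<alpha>) + ennreal e"
        using *[OF d(1,2)] d(3) by (intro add_mono ennreal_leI) auto
      finally show ?thesis .
    qed simp
  qed
qed

end

section \<open>Potentials depending on the length of the initial run\<close>

abbreviation flip :: "omega \<Rightarrow> omega" where "flip \<omega> \<equiv> Not \<circ> \<omega>"

definition run_length :: "omega \<Rightarrow> nat" where
  "run_length \<omega> = (LEAST k. \<omega> k \<noteq> \<omega> 0)"

text \<open>For constant sequences the run is infinite, hence the cost \<open>0\<close>, the limit of \<open>a\<close>; there
  \<^const>\<open>run_length\<close> is junk.\<close>

definition run_cost :: "(nat \<Rightarrow> real) \<Rightarrow> omega \<Rightarrow> real" where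
  "run_cost a \<omega> = (if \<exists>k. \<omega> k \<noteq> \<omega> 0 then a (run_length \<omega>) else 0)"

definition run_fun :: "(nat \<Rightarrow> real) \<Rightarrow> omega \<Rightarrow> real" where
  "run_fun a \<omega> = (if \<omega> 0 then 1 - run_cost a \<omega> else run_cost a \<omega> - 1)"

lemma run_length_eqI:
  assumes "\<omega> r \<noteq> \<omega> 0" "\<And>k. k < r \<Longrightarrow> \<omega> k = \<omega> 0"
  shows "run_length \<omega> = r"
  unfolding run_length_def using assms by (intro Least_equality) (auto simp: not_less[symmetric])

lemma run_length_less: "k < run_length \<omega> \<Longrightarrow> \<omega> k = \<omega> 0"
  unfolding run_length_def using not_less_Least by blast

lemma run_length_neq: "\<exists>k. \<omega> k \<noteq> \<omega> 0 \<Longrightarrow> \<omega> (run_length \<omega>) \<noteq> \<omega> 0"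
  unfolding run_length_def by (rule LeastI_ex)

lemma run_length_pos: "\<exists>k. \<omega> k \<noteq> \<omega> 0 \<Longrightarrow> run_length \<omega> > 0"
  using run_length_neq by (metis gr0I)

lemma run_length_build_same:
  assumes "\<exists>k. \<omega> k \<noteq> \<omega> 0"
  shows "run_length (\<omega> 0 ## \<omega>) = Suc (run_length \<omega>)"
proof (rule run_length_eqI)
  fix k assume "k < Suc (run_length \<omega>)"
  then show "(\<omega> 0 ## \<omega>) k = (\<omega> 0 ## \<omega>) 0" using run_length_less[of "k - 1" \<omega>] by (cases k) auto
qed (use run_length_neq[OF assms] in simp)

lemma run_length_build_diff: "b \<noteq> \<omega> 0 \<Longrightarrow> run_length (b ## \<omega>) = 1"
  by (rule run_length_eqI) auto

lemma ex_change_build: "\<exists>k. \<omega> k \<noteq> \<omega> 0 \<Longrightarrow> \<exists>k. (b ## \<omega>) k \<noteq> (b ## \<omega>) 0"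
  by (metis build.simps)

section \<open>Exchange of zeros and ones, and the vanishing mean\<close>

lemma run_fun_flip: "run_fun a (flip \<omega>) = - run_fun a \<omega>"
proof -
  have "run_length (flip \<omega>) = run_length \<omega>" by (simp add: run_length_def)
  moreover have "(\<exists>k. flip \<omega> k \<noteq> flip \<omega> 0) \<longleftrightarrow> (\<exists>k. \<omega> k \<noteq> \<omega> 0)" by auto
  ultimately have "run_cost a (flip \<omega>) = run_cost a \<omega>" unfolding run_cost_def by presburger
  then show ?thesis by (simp add: run_fun_def)
qed

lemma bsum_run_fun_flip: "bsum (run_fun a) n (flip \<omega>) = - bsum (run_fun a) n \<omega>"
proof -
  have "suffix k (flip \<omega>) = flip (suffix k \<omega>)" for k by (auto simp: fun_eq_iff)
  then show ?thesis by (simp add: bsum_def run_fun_flip sum_negf del: suffix_nth)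
qed

lemma measurable_flip: "flip \<in> measurable bernoulli_omega bernoulli_omega"
proof -
  have "(\<lambda>\<omega> i. \<not> \<omega> i) \<in> measurable bernoulli_omega bernoulli_omega"
    unfolding bernoulli_omega_def
  proof (rule measurable_PiM_single')
    fix i :: nat
    have "(\<lambda>\<omega>. \<omega> i) \<in> measurable (PiM UNIV (\<lambda>_ :: nat. measure_pmf (bernoulli_pmf (1 / 2)))) (measure_pmf (bernoulli_pmf (1 / 2)))"
      by (rule measurable_component_singleton) simp
    then show "(\<lambda>\<omega>. \<not> \<omega> i) \<in> measurable (PiM UNIV (\<lambda>_ :: nat. measure_pmf (bernoulli_pmf (1 / 2)))) (measure_pmf (bernoulli_pmf (1 / 2)))"
      by (rule measurable_compose) simp
  qed (simp add: space_PiM)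
  then show ?thesis by (simp add: comp_def)
qed

lemma distr_bernoulli_flip: "distr bernoulli_omega bernoulli_omega flip = bernoulli_omega"
proof -
  interpret product_prob_space "\<lambda>_ :: nat. measure_pmf (bernoulli_pmf (1 / 2))" UNIV ..
  note measurable_flip [measurable]
  have sp: "space bernoulli_omega = UNIV" by (simp add: bernoulli_omega_def space_PiM)
  have flip_pmf: "map_pmf Not (bernoulli_pmf (1 / 2)) = bernoulli_pmf (1 / 2)"
  proof (rule pmf_eqI)
    fix b
    have "pmf (map_pmf Not (bernoulli_pmf (1 / 2))) (Not (\<not> b)) = pmf (bernoulli_pmf (1 / 2)) (\<not> b)"
      by (rule pmf_map_inj') (simp add: inj_def)
    then show "pmf (map_pmf Not (bernoulli_pmf (1 / 2))) b = pmf (bernoulli_pmf (1 / 2)) b"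
      by (cases b) simp_all
  qed
  show ?thesis
    unfolding bernoulli_omega_def
  proof (rule PiM_eq)
    fix J :: "nat set" and F :: "nat \<Rightarrow> bool set"
    assume J: "finite J"
    let ?M = "PiM UNIV (\<lambda>_ :: nat. measure_pmf (bernoulli_pmf (1 / 2)))"
    have emb: "emb UNIV J (Pi\<^sub>E J F) = {x\<in>space ?M. \<forall>j\<in>J. x j \<in> F j}" for F :: "nat \<Rightarrow> bool set"
      unfolding prod_emb_def by (auto simp: space_PiM Pi_iff)
    have "emeasure (distr ?M ?M flip) (emb UNIV J (Pi\<^sub>E J F))
        = emeasure ?M (flip -` (emb UNIV J (Pi\<^sub>E J F)) \<inter> space ?M)"
      using J measurable_flip by (intro emeasure_distr) (auto simp: bernoulli_omega_def)
    also have "flip -` (emb UNIV J (Pi\<^sub>E J F)) \<inter> space ?M = {x\<in>space ?M. \<forall>j\<in>J. x j \<in> Not -` F j}"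
      unfolding emb by (auto simp: space_PiM)
    also have "emeasure ?M \<dots> = (\<Prod>j\<in>J. emeasure (measure_pmf (bernoulli_pmf (1 / 2))) (Not -` F j))"
      using J by (intro emeasure_PiM_Collect) auto
    also have "\<dots> = (\<Prod>j\<in>J. emeasure (measure_pmf (bernoulli_pmf (1 / 2))) (F j))"
      by (subst (2) flip_pmf[symmetric]) (simp only: emeasure_map_pmf)
    finally show "emeasure (distr ?M ?M flip) (emb UNIV J (Pi\<^sub>E J F)) =
      (\<Prod>j\<in>J. emeasure (measure_pmf (bernoulli_pmf (1 / 2))) (F j))" .
  qed simp
qed

text \<open>The function is odd under \<open>flip\<close>, which preserves the fair product measure.
  A non-integrable function would have integral 0 by the default value.\<close>

lemma integral_run_fun: "(\<integral>\<omega>. run_fun a \<omega> \<partial>bernoulli_omega) = 0"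
proof (cases "integrable bernoulli_omega (run_fun a)")
  case True
  note measurable_flip [measurable]
  have "(\<integral>\<omega>. run_fun a \<omega> \<partial>bernoulli_omega) = (\<integral>\<omega>. run_fun a \<omega> \<partial>distr bernoulli_omega bernoulli_omega flip)"
    by (simp add: distr_bernoulli_flip)
  also have "\<dots> = (\<integral>\<omega>. run_fun a (flip \<omega>) \<partial>bernoulli_omega)"
    using True by (intro integral_distr) auto
  also have "\<dots> = - (\<integral>\<omega>. run_fun a \<omega> \<partial>bernoulli_omega)" by (simp add: run_fun_flip)
  finally show ?thesis by simp
qed (rule not_integrable_integral_eq)

text \<open>Runs have length at least 1, so \<open>a 0\<close> is not the cost of a run: its value 2
  is the length of the range [-1, 1] and makes \<open>a j\<close> a bound for the variation on
  cylinders of length \<open>j\<close> also at \<open>j = 0\<close>.\<close>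

locale run_potential =
  fixes a :: "nat \<Rightarrow> real"
  assumes antimono_a: "antimono a" and a_0: "a 0 = 2" and a_1: "a 1 \<le> 1"
    and a_nonneg: "\<And>k. a k \<ge> 0" and a_lim: "a \<longlonglongrightarrow> 0"
begin

lemma run_cost_nonneg: "run_cost a \<omega> \<ge> 0"
  using a_nonneg by (simp add: run_cost_def)

lemma run_cost_le: "(\<And>k. k < j \<Longrightarrow> \<omega> k = \<omega> 0) \<Longrightarrow> run_cost a \<omega> \<le> a j"
  using run_length_neq[of \<omega>] antimonoD[OF antimono_a, of j "run_length \<omega>"] a_nonneg[of j]
  by (auto simp: run_cost_def not_less[symmetric])

lemma run_cost_le_1: "run_cost a \<omega> \<le> 1"
  using run_cost_le[of 1 \<omega>] a_1 by simp

lemma run_cost_cong: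
  assumes "prefix j x = prefix j y" "k < j" "x k \<noteq> x 0"
  shows "run_cost a x = run_cost a y"
proof -
  have eq: "x i = y i" if "i < j" for i using assms(1) that by (simp add: prefix_eq_iff)
  have "run_length x \<le> k" unfolding run_length_def using assms(3) by (rule Least_le)
  then have r: "run_length x < j" using assms(2) by simp
  have "run_length y = run_length x"
  proof (rule run_length_eqI)
    show "y (run_length x) \<noteq> y 0" using run_length_neq[of x] assms eq r by fastforce
    show "y i = y 0" if "i < run_length x" for i using run_length_less[OF that] eq r that by fastforce
  qed
  moreover have "\<exists>k. y k \<noteq> y 0" using assms eq[of k] eq[of 0] by (intro exI[of _ k]) auto
  ultimately show ?thesis using assms(3) by (auto simp: run_cost_def)
qed

lemma abs_run_fun_le_1: "\<bar>run_fun a \<omega>\<bar> \<le> 1"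
  using run_cost_nonneg[of \<omega>] run_cost_le_1[of \<omega>] by (simp add: run_fun_def)

text \<open>If the first run ends within the common prefix, both values agree. Otherwise both runs
  have length at least \<open>j\<close>, or are infinite, and both costs lie between 0 and
  \<open>a j\<close>.\<close>

lemma run_fun_diff_le:
  assumes "prefix j x = prefix j y"
  shows "\<bar>run_fun a x - run_fun a y\<bar> \<le> a j"
proof (cases "j = 0")
  case True
  then have "a j = 2" using a_0 by simp
  then show ?thesis using abs_run_fun_le_1[of x] abs_run_fun_le_1[of y] by linarith
next
  case False
  then have eq: "x 0 = y 0" using assms by (simp add: prefix_eq_iff)
  show ?thesis
  proof (cases "\<exists>k<j. x k \<noteq> x 0")
    case True
    then have "run_cost a x = run_cost a y" using run_cost_cong[OF assms] by blast
    then show ?thesis using eq a_nonneg by (simp add: run_fun_def)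
  next
    case F: False
    then have const: "x k = x 0" if "k < j" for k using that by blast
    then have "run_cost a x \<le> a j" by (rule run_cost_le)
    moreover have "run_cost a y \<le> a j"
    proof (rule run_cost_le)
      fix k assume "k < j"
      then have "x k = y k" using assms by (simp add: prefix_eq_iff)
      then show "y k = y 0" using const[OF \<open>k < j\<close>] eq by simp
    qed
    ultimately have "\<bar>run_cost a x - run_cost a y\<bar> \<le> a j"
      using run_cost_nonneg[of x] run_cost_nonneg[of y] by linarith
    then show ?thesis using eq by (simp add: run_fun_def abs_minus_commute)
  qed
qed

sublocale birkhoff "run_fun a" 1 "\<lambda>n. \<Sum>j<n. a j"
proof
  fix n and x y :: omega assume p: "prefix n x = prefix n y"
  have "\<bar>bsum (run_fun a) n x - bsum (run_fun a) n y\<bar>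
      \<le> (\<Sum>k=1..n. \<bar>run_fun a (suffix k x) - run_fun a (suffix k y)\<bar>)"
    unfolding bsum_def sum_subtractf[symmetric] by (rule sum_abs)
  \<comment> \<open>After \<open>k\<close> shifts the two sequences still share \<open>n - k\<close>
    letters.\<close>
  also have "\<dots> \<le> (\<Sum>k=1..n. a (n - k))"
    by (intro sum_mono run_fun_diff_le) (use p in \<open>auto simp: prefix_eq_iff simp del: subsequence_shift\<close>)
  also have "\<dots> = (\<Sum>j<n. a j)"
    by (rule sum.reindex_bij_witness[of _ "\<lambda>j. n - j" "\<lambda>k. n - k"]) auto
  finally show "\<bar>bsum (run_fun a) n x - bsum (run_fun a) n y\<bar> \<le> (\<Sum>j<n. a j)" .
qed (simp_all add: abs_run_fun_le_1 sublin_sum[OF a_lim])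

lemma run_fun_C0: "run_fun a \<in> C0_omega"
proof -
  interpret M: Metric_space UNIV dist_omega by (rule Metric_space_dist_omega)
  have "openin M.mtopology {x. run_fun a x \<in> U}" if "open U" for U
    unfolding M.openin_mtopology
  proof safe
    fix x assume "run_fun a x \<in> U"
    then obtain e where e: "e > 0" "\<And>y. dist y (run_fun a x) < e \<Longrightarrow> y \<in> U"
      using \<open>open U\<close> by (auto simp: open_dist)
    obtain j where j: "a j < e"
      using order_tendstoD(2)[OF a_lim e(1)] by (auto simp: eventually_sequentially)
    show "\<exists>r>0. M.mball x r \<subseteq> {x. run_fun a x \<in> U}"
    proof (intro exI[of _ "(1 / 2) ^ j"] conjI subsetI)
      fix y assume "y \<in> M.mball x ((1 / 2) ^ j)"
      then have "prefix j x = prefix j y" by (intro prefix_eq_if_dist_omega) (simp add: M.mball_def)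
      then have "\<bar>run_fun a x - run_fun a y\<bar> \<le> a j" by (rule run_fun_diff_le)
      then show "y \<in> {x. run_fun a x \<in> U}" using e(2)[of "run_fun a y"] j by (simp add: dist_real_def)
    qed simp
  qed simp
  then have "run_fun a \<in> C_omega" by (simp add: C_omega_def continuous_map_def)
  then show ?thesis by (simp add: C0_omega_def integral_run_fun)
qed

text \<open>Complementing the letters of a word and of its continuation negates the sum; one
  inequality, applied to \<open>c\<close> and to \<open>- c\<close>, gives both.\<close>

lemma card_level_words_uminus: "card (level_words n (- c) r) = card (level_words n c r)"
proof -
  have "card (level_words n c r) \<le> card (level_words n (- c) r)" for c
  proof (rule card_inj_on_le)
    show "map Not ` level_words n c r \<subseteq> level_words n (- c) r"
    proof safe
      fix w assume "w \<in> level_words n c r"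
      then obtain x where w: "length w = n" "\<bar>bsum (run_fun a) n (w \<frown> x) - c\<bar> \<le> r"
        by (auto simp: level_words_def)
      have "bsum (run_fun a) n (map Not w \<frown> flip x) = - bsum (run_fun a) n (w \<frown> x)"
        unfolding bsum_run_fun_flip[symmetric] by (simp add: comp_concat)
      then have "\<bar>bsum (run_fun a) n (map Not w \<frown> flip x) - - c\<bar> \<le> r" using w by simp
      then show "map Not w \<in> level_words n (- c) r" unfolding level_words_def using w by auto
    qed
    show "inj_on (map Not) (level_words n c r)" by (intro inj_on_subset[OF inj_mapI]) (auto simp: inj_def)
  qed simp
  from this[of c] this[of "- c"] show ?thesis by simp
qed

lemma bsum_const: "bsum (run_fun a) n (\<lambda>_. b) = real n * (if b then 1 else -1)"
proof -
  have "suffix k (\<lambda>_. b) = (\<lambda>_. b)" for k by (auto simp: fun_eq_iff)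
  then show ?thesis by (simp add: bsum_def run_fun_def run_cost_def del: suffix_nth)
qed

lemma growth_ge_const: "growth_ge (if b then 1 else -1) 0"
  unfolding growth_ge_def
proof (intro exI conjI allI)
  fix n
  have "prefix n (\<lambda>_. b) \<in> level_words n (real n * (if b then 1 else -1)) 0"
    by (intro prefix_in_level_words) (simp add: bsum_const)
  then have "card (level_words n (real n * (if b then 1 else -1)) 0) > 0"
    by (subst card_gt_0_iff) auto
  then show "2 powr (real n * 0 - 0) \<le> real (card (level_words n (real n * (if b then 1 else - 1)) 0))" by simp
qed (rule sublin_const)

text \<open>The pigeonhole principle gives a common value of the sum shared by a large set of words of
  length \<open>n div 2\<close>; such words are concatenated with complements of such words.\<close>

lemma growth_ge_0: "growth_ge 0 1"
proof -
  define V where "V n = (\<Sum>j<n. a j)" for n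
  \<comment> \<open>The two \<open>V\<close> terms come from the two concatenations and the two
    logarithms from using the pigeonhole bound twice. The 3 is the tolerance 1 of each half plus 1
    for the letter left over when \<open>n\<close> is odd.\<close>
  define u where "u n = V (n div 2) + V (2 * (n div 2)) + (log 2 (real n + 1) + log 2 (real n + 1)) + 3" for n
  have sV: "sublin V" unfolding V_def by (rule sublin_sum[OF a_lim])
  have "sublin u"
    unfolding u_def by (intro sublin_add sublin_const sublin_log sublin_compose[OF sV]) auto
  moreover have "2 powr (real n * 1 - u n) \<le> real (card (level_words n (real n * 0) (u n)))" for n
  proof -
    define L where "L = n div 2"
    define g where "g w = \<lfloor>bsum (run_fun a) L (w \<frown> (\<lambda>_. True))\<rfloor>" for w
    define A where "A = {w :: bool list. set w \<subseteq> UNIV \<and> length w = L}"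
    have cA: "card A = 2 ^ L" unfolding A_def using card_lists_length_eq[of "UNIV :: bool set" L] by simp
    have fA: "finite A" unfolding A_def by (rule finite_lists_length_eq) simp
    have "g w \<in> {- int L..int L}" for w
      using abs_bsum_le[of L "w \<frown> (\<lambda>_. True)"] unfolding g_def by (auto simp: le_floor_iff floor_le_iff)
    then have "\<exists>z\<in>{- int L..int L}. card A \<le> card (g -` {z} \<inter> A) * card {- int L..int L}"
      by (intro pigeonhole_card fA) auto
    then obtain z where z: "card A \<le> card (g -` {z} \<inter> A) * (2 * L + 1)" by (auto simp: nat_add_distrib nat_mult_distrib)
    define c where "c = card (level_words L (real_of_int z) 1)"
    have "g -` {z} \<inter> A \<subseteq> level_words L (real_of_int z) 1"
    proof
      fix w assume "w \<in> g -` {z} \<inter> A"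
      then have "length w = L" "\<bar>bsum (run_fun a) L (w \<frown> (\<lambda>_. True)) - real_of_int z\<bar> \<le> 1"
        by (auto simp: g_def A_def abs_le_iff) linarith+
      then show "w \<in> level_words L (real_of_int z) 1" by (auto simp: level_words_def)
    qed
    then have "card (g -` {z} \<inter> A) \<le> c" unfolding c_def by (intro card_mono) auto
    then have "2 ^ L \<le> c * (2 * L + 1)" using z cA by (metis le_trans mult_le_mono1)
    also have "\<dots> \<le> c * (n + 1)" by (intro mult_le_mono) (auto simp: L_def)
    finally have "real (2 ^ L) \<le> real (c * (n + 1))" by (rule of_nat_mono)
    then have c: "2 ^ L \<le> real c * (real n + 1)" by (simp add: algebra_simps)
    have r: "2 * L + (n - 2 * L) = n" by (simp add: L_def)
    have one: "real (n - 2 * L) * 1 + \<bar>0\<bar> \<le> 1" unfolding L_def by (cases "even n") (auto elim!: evenE oddE)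
    have "c * c \<le> card (level_words (L + L) (real_of_int z + - real_of_int z) (1 + 1 + V L))"
      using card_level_words_mult[of L "real_of_int z" 1 L "- real_of_int z" 1] by (simp add: c_def V_def card_level_words_uminus)
    then have "c * c * 2 ^ (n - 2 * L) \<le> card (level_words (2 * L) 0 (2 + V L)) * card (level_words (n - 2 * L) 0 1)"
      unfolding card_level_words_eq[OF one] by (intro mult_le_mono1) (simp add: mult_2)
    also have "\<dots> \<le> card (level_words (2 * L + (n - 2 * L)) (0 + 0) ((2 + V L) + 1 + V (2 * L)))"
      unfolding V_def by (rule card_level_words_mult)
    also have "\<dots> \<le> card (level_words n 0 (u n))"
      unfolding r by (intro card_level_words_mono) (simp add: u_def L_def)
    finally have *: "c * c * 2 ^ (n - 2 * L) \<le> card (level_words n 0 (u n))" .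
    have V0: "V n \<ge> 0" for n unfolding V_def by (intro sum_nonneg a_nonneg)
    have "2 powr (real n * 1 - u n) \<le> 2 powr (real n - (log 2 (real n + 1) + log 2 (real n + 1)))"
      using V0[of "n div 2"] V0[of "2 * (n div 2)"] by (intro powr_mono) (auto simp: u_def)
    also have "\<dots> = 2 ^ n / ((real n + 1) * (real n + 1))"
      unfolding powr_diff powr_add by (simp add: powr_realpow)
    also have "\<dots> = (2 ^ L / (real n + 1)) * (2 ^ L / (real n + 1)) * 2 ^ (n - 2 * L)"
    proof -
      have "(2 :: real) ^ n = 2 ^ L * 2 ^ L * 2 ^ (n - 2 * L)" by (metis r power_add mult_2)
      then show ?thesis by simp
    qed
    also have "\<dots> \<le> real c * real c * 2 ^ (n - 2 * L)"
      using c by (intro mult_right_mono mult_mono) (auto simp: divide_le_eq)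
    also have "\<dots> = real (c * c * 2 ^ (n - 2 * L))" by simp
    also have "\<dots> \<le> real (card (level_words n 0 (u n)))" using * by (rule of_nat_mono)
    finally show ?thesis by simp
  qed
  ultimately show ?thesis unfolding growth_ge_def by blast
qed

lemma growth_ge_tent:
  assumes "\<bar>\<alpha>\<bar> \<le> 1"
  shows "growth_ge \<alpha> (1 - \<bar>\<alpha>\<bar>)"
proof -
  have "growth_ge (\<bar>\<alpha>\<bar> * (if \<alpha> \<ge> 0 then 1 else -1) + (1 - \<bar>\<alpha>\<bar>) * 0) (\<bar>\<alpha>\<bar> * 0 + (1 - \<bar>\<alpha>\<bar>) * 1)"
    using assms by (intro growth_ge_convex growth_ge_const growth_ge_0) auto
  then show ?thesis by (cases "\<alpha> \<ge> 0") auto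
qed

end

section \<open>The transfer operator bound and the shape of the spectrum\<close>

text \<open>Indices start at 0, unlike in \<open>bsum\<close>, so that prepending a letter adds
  exactly one new summand, as iterating the transfer operator requires.\<close>

definition cost_sum :: "(nat \<Rightarrow> real) \<Rightarrow> nat \<Rightarrow> omega \<Rightarrow> real" where
  "cost_sum a n \<omega> = (\<Sum>k<n. 1 - run_fun a (suffix k \<omega>))"

lemma cost_sum_build: "cost_sum a (Suc n) (b ## \<omega>) = (1 - run_fun a (b ## \<omega>)) + cost_sum a n \<omega>"
proof -
  have "suffix (Suc k) (b ## \<omega>) = suffix k \<omega>" for k by (auto simp: fun_eq_iff)
  then show ?thesis unfolding cost_sum_def sum.lessThan_Suc_shift by (simp del: suffix_nth)
qed

lemma ex_change_conc: "\<exists>k. \<omega> k \<noteq> \<omega> 0 \<Longrightarrow> \<exists>k. (w \<frown> \<omega>) k \<noteq> (w \<frown> \<omega>) 0"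
proof (induction w)
  case (Cons b w)
  show ?case unfolding build_cons using Cons by (intro ex_change_build) blast
qed simp

text \<open>The left side is the \<open>n\<close>-th iterate of the transfer operator applied to
  \<open>h\<close>. Prepending letters preserves non-constancy, so subinvariance can be iterated
  along \<omega>.\<close>

lemma sum_words_le:
  fixes h :: "omega \<Rightarrow> real"
  assumes sub: "\<And>\<omega>. \<exists>k. \<omega> k \<noteq> \<omega> 0 \<Longrightarrow>
      (\<Sum>b\<in>UNIV. 2 powr (- \<tau> * (1 - run_fun a (b ## \<omega>))) * h (b ## \<omega>)) \<le> h \<omega>"
    and \<omega>: "\<exists>k. \<omega> k \<noteq> \<omega> 0"
  shows "(\<Sum>w | length w = n. 2 powr (- \<tau> * cost_sum a n (w \<frown> \<omega>)) * h (w \<frown> \<omega>)) \<le> h \<omega>"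
proof (induction n)
  case (Suc n)
  define T where "T n w = 2 powr (- \<tau> * cost_sum a n (w \<frown> \<omega>)) * h (w \<frown> \<omega>)" for n w
  have "(\<Sum>w | length w = Suc n. T (Suc n) w) = (\<Sum>(w, b)\<in>{w. length w = n} \<times> UNIV. T (Suc n) (b # w))"
    by (rule sum.reindex_bij_witness[of _ "\<lambda>(w, b). b # w" "\<lambda>w. (tl w, hd w)"]) (auto simp: length_Suc_conv)
  also have "\<dots> = (\<Sum>w | length w = n. \<Sum>b\<in>UNIV. T (Suc n) (b # w))"
    by (rule sum.cartesian_product[symmetric])
  also have "\<dots> \<le> (\<Sum>w | length w = n. T n w)"
  proof (rule sum_mono)
    fix w
    have "(\<Sum>b\<in>UNIV. T (Suc n) (b # w)) = 2 powr (- \<tau> * cost_sum a n (w \<frown> \<omega>)) *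
        (\<Sum>b\<in>UNIV. 2 powr (- \<tau> * (1 - run_fun a (b ## w \<frown> \<omega>))) * h (b ## w \<frown> \<omega>))"
      unfolding T_def build_cons cost_sum_build distrib_left powr_add sum_distrib_left by (simp add: mult_ac)
    also have "\<dots> \<le> T n w"
      unfolding T_def by (intro mult_left_mono sub ex_change_conc \<omega>) simp
    finally show "(\<Sum>b\<in>UNIV. T (Suc n) (b # w)) \<le> T n w" .
  qed
  also have "\<dots> \<le> h \<omega>" using Suc by (simp add: T_def)
  finally show ?case by (simp add: T_def)
qed (simp add: cost_sum_def)

context run_potential
begin

text \<open>The index ranges of the two sums differ by one term at either end, each of absolute
  value at most 1.\<close>

lemma cost_sum_le: "cost_sum a n \<omega> \<le> real n - bsum (run_fun a) n \<omega> + 2"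
proof -
  have "(\<Sum>k<n. run_fun a (suffix k \<omega>)) + run_fun a (suffix n \<omega>) = run_fun a \<omega> + bsum (run_fun a) n \<omega>"
    unfolding bsum_def by (induction n) (simp_all del: suffix_nth)
  then show ?thesis
    using abs_run_fun_le_1[of \<omega>] abs_run_fun_le_1[of "suffix n \<omega>"]
    unfolding cost_sum_def sum_subtractf by simp
qed

text \<open>A Chebyshev argument: each level word contributes at least
  \<open>2 powr (- \<tau> * R) * c\<close> to a weighted sum that never exceeds
  \<open>h \<omega>0\<close>, which bounds the number of such words.\<close>

lemma hausdorff_dim_le_of_subinvariant:
  fixes h :: "omega \<Rightarrow> real"
  assumes \<tau>: "\<tau> > 0" and c: "c > 0" "\<And>\<omega>. \<exists>k. \<omega> k \<noteq> \<omega> 0 \<Longrightarrow> h \<omega> \<ge> c"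
    and sub: "\<And>\<omega>. \<exists>k. \<omega> k \<noteq> \<omega> 0 \<Longrightarrow>
      (\<Sum>b\<in>UNIV. 2 powr (- \<tau> * (1 - run_fun a (b ## \<omega>))) * h (b ## \<omega>)) \<le> h \<omega>"
    and \<alpha>: "\<bar>\<alpha>\<bar> \<le> 1"
  shows "hausdorff_dim dist_omega (E_set (run_fun a) \<alpha>) \<le> ennreal (\<tau> * (1 - \<bar>\<alpha>\<bar>))"
proof (rule ennreal_le_epsilon)
  fix e :: real assume e: "e > 0"
  \<comment> \<open>One third of \<open>e\<close> for the tolerance of the level words, one for the
    linear part of \<open>V\<close>, and one to absorb the constant \<open>K\<close> for large
    \<open>n\<close>.\<close>
  define \<delta> where "\<delta> = e / (3 * \<tau>)"
  have d: "\<delta> > 0" using e \<tau> by (simp add: \<delta>_def)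
  define \<omega>0 :: omega where "\<omega>0 = (\<lambda>k. k = 0)"
  have nc: "\<exists>k. \<omega>0 k \<noteq> \<omega>0 0" by (auto simp: \<omega>0_def)
  define V where "V n = (\<Sum>j<n. a j)" for n
  obtain C where C: "\<And>n. V n \<le> \<delta> * real n + C"
    using sublinE[OF sublin_V d] unfolding V_def by metis
  have h0: "h \<omega>0 > 0" using c(1) c(2)[OF nc] by simp
  define K where "K = log 2 (h \<omega>0 / c) + \<tau> * (C + 2)"
  have card_le: "real (card (level_words n (real n * \<bar>\<alpha>\<bar>) (real n * \<delta>))) \<le> 2 powr (real n * (\<tau> * (1 - \<bar>\<alpha>\<bar>) + 2 * \<tau> * \<delta>) + K)" for n
  proof -
    define W where "W = level_words n (real n * \<bar>\<alpha>\<bar>) (real n * \<delta>)"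
    define R where "R = real n * (1 - \<bar>\<alpha>\<bar> + 2 * \<delta>) + (C + 2)"
    have fin: "finite {w :: bool list. length w = n}"
      using finite_lists_length_eq[of "UNIV :: bool set" n] by simp
    have "real (card W) * (2 powr (- \<tau> * R) * c) = (\<Sum>w\<in>W. 2 powr (- \<tau> * R) * c)" by simp
    also have "\<dots> \<le> (\<Sum>w\<in>W. 2 powr (- \<tau> * cost_sum a n (w \<frown> \<omega>0)) * h (w \<frown> \<omega>0))"
    proof (rule sum_mono)
      fix w assume "w \<in> W"
      then have "\<bar>bsum (run_fun a) n (w \<frown> \<omega>0) - real n * \<bar>\<alpha>\<bar>\<bar> \<le> real n * \<delta> + V n"
        unfolding W_def V_def by (rule level_words_bsum)
      then have "cost_sum a n (w \<frown> \<omega>0) \<le> R"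
        using cost_sum_le[of n "w \<frown> \<omega>0"] C[of n] by (simp add: R_def algebra_simps abs_le_iff)
      then have "2 powr (- \<tau> * R) \<le> 2 powr (- \<tau> * cost_sum a n (w \<frown> \<omega>0))"
        using \<tau> by (intro powr_mono) auto
      then show "2 powr (- \<tau> * R) * c \<le> 2 powr (- \<tau> * cost_sum a n (w \<frown> \<omega>0)) * h (w \<frown> \<omega>0)"
        using c(1) c(2)[OF ex_change_conc[OF nc, of w]] by (intro mult_mono) auto
    qed
    also have "\<dots> \<le> (\<Sum>w | length w = n. 2 powr (- \<tau> * cost_sum a n (w \<frown> \<omega>0)) * h (w \<frown> \<omega>0))"
    proof (rule sum_mono2[OF fin])
      fix w assume "w \<in> {w. length w = n} - W"
      show "0 \<le> 2 powr (- \<tau> * cost_sum a n (w \<frown> \<omega>0)) * h (w \<frown> \<omega>0)"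
        using c(1) c(2)[OF ex_change_conc[OF nc, of w]] by simp
    qed (auto simp: W_def level_words_def)
    also have "\<dots> \<le> h \<omega>0" by (rule sum_words_le[OF sub nc])
    finally have "real (card W) * (2 powr (- \<tau> * R) * c) \<le> h \<omega>0" .
    then have "real (card W) \<le> (h \<omega>0 / c) * 2 powr (\<tau> * R)"
      using c(1) by (simp add: powr_minus field_simps)
    also have "h \<omega>0 / c = 2 powr (log 2 (h \<omega>0 / c))" using h0 c(1) by simp
    also have "2 powr (log 2 (h \<omega>0 / c)) * 2 powr (\<tau> * R)
        = 2 powr (real n * (\<tau> * (1 - \<bar>\<alpha>\<bar>) + 2 * \<tau> * \<delta>) + K)"
      unfolding powr_add[symmetric] by (simp add: R_def K_def algebra_simps)
    finally show ?thesis by (simp add: W_def)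
  qed
  have "hausdorff_dim dist_omega (E_set (run_fun a) \<alpha>) \<le> ennreal (\<tau> * (1 - \<bar>\<alpha>\<bar>) + e)"
  proof (rule hausdorff_dim_E_le[OF _ d])
    show "0 \<le> \<tau> * (1 - \<bar>\<alpha>\<bar>) + e" using \<tau> e \<alpha> by simp
    fix n0
    obtain n1 where n1: "real n1 \<ge> K / (\<tau> * \<delta>)" using real_arch_simple by blast
    define n where "n = max n0 n1"
    have "K \<le> real n * (\<tau> * \<delta>)"
    proof -
      have "K / (\<tau> * \<delta>) \<le> real n" using n1 by (simp add: n_def)
      then show ?thesis using \<tau> d by (simp add: pos_divide_le_eq)
    qed
    then have "real n * (\<tau> * (1 - \<bar>\<alpha>\<bar>) + 2 * \<tau> * \<delta>) + K \<le> real n * (\<tau> * (1 - \<bar>\<alpha>\<bar>) + 3 * \<tau> * \<delta>)"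
      by (simp add: algebra_simps)
    also have "3 * \<tau> * \<delta> = e" using \<tau> by (simp add: \<delta>_def)
    finally have "2 powr (real n * (\<tau> * (1 - \<bar>\<alpha>\<bar>) + 2 * \<tau> * \<delta>) + K) \<le> 2 powr (real n * (\<tau> * (1 - \<bar>\<alpha>\<bar>) + e))"
      by simp
    moreover have "card (level_words n (real n * \<alpha>) (real n * \<delta>)) = card (level_words n (real n * \<bar>\<alpha>\<bar>) (real n * \<delta>))"
      using card_level_words_uminus[of n "real n * \<alpha>"] by (cases "\<alpha> \<ge> 0") auto
    ultimately have "real (card (level_words n (real n * \<alpha>) (real n * \<delta>))) \<le> 2 powr (real n * (\<tau> * (1 - \<bar>\<alpha>\<bar>) + e))"
      using card_le[of n] by linarith
    then show "\<exists>n\<ge>n0. real (card (level_words n (real n * \<alpha>) (real n * \<delta>))) \<le> 2 powr (real n * (\<tau> * (1 - \<bar>\<alpha>\<bar>) + e))"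
      by (intro exI[of _ n]) (simp add: n_def)
  qed
  then show "hausdorff_dim dist_omega (E_set (run_fun a) \<alpha>) \<le> ennreal (\<tau> * (1 - \<bar>\<alpha>\<bar>)) + ennreal e"
    using e \<tau> \<alpha> by simp
qed

end

section \<open>Shape of a spectrum lying below a tent\<close>

locale tent_bounded = run_potential +
  fixes \<tau> :: real
  assumes \<tau>_pos: "\<tau> > 0"
    and dim_le: "\<And>\<alpha>. \<bar>\<alpha>\<bar> \<le> 1 \<Longrightarrow>
      hausdorff_dim dist_omega (E_set (run_fun a) \<alpha>) \<le> ennreal (\<tau> * (1 - \<bar>\<alpha>\<bar>))"
begin

abbreviation S :: "real \<Rightarrow> real" where "S \<equiv> birkhoff_spectrum (run_fun a)"

lemma ennreal_S: "\<bar>\<alpha>\<bar> \<le> 1 \<Longrightarrow> ennreal (S \<alpha>) = hausdorff_dim dist_omega (E_set (run_fun a) \<alpha>)"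
  unfolding birkhoff_spectrum_def
  by (intro ennreal_enn2real) (metis dim_le ennreal_less_top order_le_less_trans)

lemma S_nonneg: "S \<alpha> \<ge> 0"
  by (simp add: birkhoff_spectrum_def)

lemma S_le: "\<bar>\<alpha>\<bar> \<le> 1 \<Longrightarrow> S \<alpha> \<le> \<tau> * (1 - \<bar>\<alpha>\<bar>)"
  using dim_le[of \<alpha>] \<tau>_pos by (simp add: ennreal_S[symmetric])

lemma growth_ge_S:
  assumes "\<bar>\<alpha>\<bar> \<le> 1"
  shows "growth_ge \<alpha> (S \<alpha>)"
proof (cases "S \<alpha> = 0")
  \<comment> \<open>Dimension 0 gives no word count through
    \<open>growth_ge_of_hausdorff_dim\<close>, which needs a positive exponent; the tent bound
    supplies it.\<close>
  case True
  then show ?thesis using growth_ge_mono[OF growth_ge_tent[OF assms], of 0] assms by simp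
next
  case False
  then show ?thesis
    using S_nonneg[of \<alpha>] assms by (intro growth_ge_of_hausdorff_dim) (simp_all add: ennreal_S)
qed

lemma le_S:
  assumes "growth_ge \<alpha> s" "s \<ge> 0" "\<bar>\<alpha>\<bar> \<le> 1"
  shows "s \<le> S \<alpha>"
  using hausdorff_dim_E_ge[OF assms(2,1)] S_nonneg[of \<alpha>]
  by (simp add: ennreal_S[OF assms(3), symmetric])

text \<open>\<open>S \<alpha>\<close> is the largest growth rate at \<alpha>, by
  \<open>growth_ge_S\<close> and \<open>le_S\<close>, and growth rates pass to convex
  combinations.\<close>

lemma S_concave: "concave_on {-1..1} S"
proof -
  have "u * S x + v * S y \<le> S (u * x + v * y)"
    if "x \<in> {-1..1}" "y \<in> {-1..1}" "u \<ge> 0" "v \<ge> 0" "u + v = 1" for x y u v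
  proof -
    have v: "v = 1 - u" using that by simp
    have "u * x + v * y \<in> {-1..1}" using convexD[of "{-1..1 :: real}" x y u v] that by simp
    moreover have "growth_ge (u * x + v * y) (u * S x + v * S y)"
      unfolding v using that by (intro growth_ge_convex growth_ge_S) auto
    ultimately show ?thesis using that S_nonneg by (intro le_S) (auto simp: abs_le_iff)
  qed
  then show ?thesis unfolding concave_on_iff by auto
qed

lemma S_ge_tent: "\<bar>\<alpha>\<bar> \<le> 1 \<Longrightarrow> S \<alpha> \<ge> 1 - \<bar>\<alpha>\<bar>"
  by (intro le_S growth_ge_tent) auto

lemma E_set_bound: "E_set (run_fun a) \<alpha> \<noteq> {} \<Longrightarrow> \<bar>\<alpha>\<bar> \<le> 1"
proof -
  assume "E_set (run_fun a) \<alpha> \<noteq> {}"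
  then obtain \<omega> where "(\<lambda>n. (bsum (run_fun a) n \<omega> - real n * \<alpha>) / real n) \<longlonglongrightarrow> 0"
    by (auto simp: E_set_iff)
  from tendsto_add[OF this tendsto_const[of \<alpha>]]
  have lim: "(\<lambda>n. (bsum (run_fun a) n \<omega> - real n * \<alpha>) / real n + \<alpha>) \<longlonglongrightarrow> \<alpha>" by simp
  have "\<forall>\<^sub>F n in sequentially. \<bar>(bsum (run_fun a) n \<omega> - real n * \<alpha>) / real n + \<alpha>\<bar> \<le> 1"
  proof (rule eventually_mono[OF eventually_gt_at_top[of 0]])
    fix n :: nat assume "n > 0"
    then have "(bsum (run_fun a) n \<omega> - real n * \<alpha>) / real n + \<alpha> = bsum (run_fun a) n \<omega> / real n"
      by (simp add: field_simps)
    then show "\<bar>(bsum (run_fun a) n \<omega> - real n * \<alpha>) / real n + \<alpha>\<bar> \<le> 1"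
      using abs_bsum_le[of n \<omega>] \<open>n > 0\<close> by simp
  qed
  then show "\<bar>\<alpha>\<bar> \<le> 1" using tendsto_upperbound[OF tendsto_rabs[OF lim]] by simp
qed

lemma const_in_E_set: "(\<lambda>_. b) \<in> E_set (run_fun a) (if b then 1 else -1)"
  by (simp add: E_set_iff bsum_const)

lemma alpha_max: "alpha_max (run_fun a) = 1"
  unfolding alpha_max_def
proof (rule cSup_eq_maximum)
  show "1 \<in> {\<alpha>. E_set (run_fun a) \<alpha> \<noteq> {}}" using const_in_E_set[of True] by auto
qed (use E_set_bound in fastforce)

lemma alpha_min: "alpha_min (run_fun a) = -1"
  unfolding alpha_min_def
proof (rule cInf_eq_minimum)
  show "-1 \<in> {\<alpha>. E_set (run_fun a) \<alpha> \<noteq> {}}" using const_in_E_set[of False] by auto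
qed (use E_set_bound in fastforce)

lemma S_outside: "\<bar>\<alpha>\<bar> \<ge> 1 \<Longrightarrow> S \<alpha> = 0"
proof (cases "\<bar>\<alpha>\<bar> = 1")
  case True
  then show ?thesis using S_le[of \<alpha>] S_nonneg[of \<alpha>] by simp
next
  case False
  assume "\<bar>\<alpha>\<bar> \<ge> 1"
  then have "E_set (run_fun a) \<alpha> = {}" using False E_set_bound[of \<alpha>] by auto
  moreover have "hausdorff_dim dist_omega {} \<le> ennreal 0"
  proof (rule hausdorff_dim_le)
    fix s :: real
    show "hausdorff_measure dist_omega s {} = 0"
      by (rule hausdorff_measure_eq_0I) (auto intro!: exI[of _ "\<lambda>_. {}"] simp: ediam_def diam_powr_def)
  qed simp
  ultimately show ?thesis by (simp add: birkhoff_spectrum_def)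
qed

text \<open>Concavity gives continuity in the open interval only. At the endpoints and outside,
  \<open>S\<close> is squeezed between 0 and
  \<open>\<tau> * max 0 (1 - \<bar>x\<bar>)\<close>.\<close>

lemma S_continuous: "continuous_on UNIV S"
proof -
  have "isCont S \<alpha>" for \<alpha>
  proof (cases "\<bar>\<alpha>\<bar> < 1")
    case True
    have "convex_on {-1<..<1} (\<lambda>x. - S x)"
      using S_concave unfolding concave_on_def by (rule convex_on_subset) auto
    then have "continuous_on {-1<..<1} (\<lambda>x. - S x)"
      by (intro convex_on_continuous) auto
    then have "continuous_on {-1<..<1} S" using continuous_on_minus[of _ "\<lambda>x. - S x"] by simp
    then show ?thesis using True by (simp add: continuous_on_eq_continuous_at abs_less_iff)
  next
    case False
    have "(S \<longlongrightarrow> 0) (at \<alpha>)"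
    proof (rule tendsto_sandwich)
      show "\<forall>\<^sub>F x in at \<alpha>. 0 \<le> S x" using S_nonneg by simp
      have "S x \<le> \<tau> * max 0 (1 - \<bar>x\<bar>)" for x
        using S_le[of x] S_outside[of x] \<tau>_pos by (cases "\<bar>x\<bar> \<le> 1") (auto simp: max_def)
      then show "\<forall>\<^sub>F x in at \<alpha>. S x \<le> \<tau> * max 0 (1 - \<bar>x\<bar>)" by simp
      have "((\<lambda>x. \<tau> * max 0 (1 - \<bar>x\<bar>)) \<longlongrightarrow> \<tau> * max 0 (1 - \<bar>\<alpha>\<bar>)) (at \<alpha>)"
        by (intro tendsto_intros)
      moreover have "\<tau> * max 0 (1 - \<bar>\<alpha>\<bar>) = 0" using False by simp
      ultimately show "((\<lambda>x. \<tau> * max 0 (1 - \<bar>x\<bar>)) \<longlongrightarrow> 0) (at \<alpha>)" by (simp only:)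
    qed simp
    then show ?thesis using False S_outside[of \<alpha>] by (simp add: isCont_def)
  qed
  then show ?thesis by (simp add: continuous_on_eq_continuous_at)
qed

lemma S_minus: "S (- \<alpha>) = S \<alpha>"
proof -
  have "S \<alpha> \<le> S (- \<alpha>)" if "\<bar>\<alpha>\<bar> \<le> 1" for \<alpha>
  proof (rule le_S)
    have "growth_ge (- \<alpha>) s" if "growth_ge \<alpha> s" for s
      using that unfolding growth_ge_def mult_minus_right card_level_words_uminus .
    then show "growth_ge (- \<alpha>) (S \<alpha>)" using growth_ge_S[OF that] by blast
  qed (use S_nonneg that in auto)
  from this[of \<alpha>] this[of "- \<alpha>"] show ?thesis
    using S_outside[of \<alpha>] S_outside[of "- \<alpha>"] by (cases "\<bar>\<alpha>\<bar> \<le> 1") auto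
qed

text \<open>The point \<open>y\<close> lies between \<open>x\<close> and 1, and
  \<open>S 1 = 0\<close>, so the chord from \<open>x\<close> to 1 lies below the graph at
  \<open>y\<close>.\<close>

lemma slope_mono:
  assumes "0 \<le> x" "x \<le> y" "y < 1"
  shows "S x / (1 - x) \<le> S y / (1 - y)"
proof -
  define p where "p = (1 - y) / (1 - x)"
  have p: "0 \<le> p" "p \<le> 1" using assms by (auto simp: p_def)
  have "p * (1 - x) = 1 - y" using assms by (simp add: p_def)
  then have y: "y = p * x + (1 - p) * 1" by (simp add: algebra_simps)
  have "(1 - (1 - p)) * S x + (1 - p) * S 1 \<le> S ((1 - (1 - p)) *\<^sub>R x + (1 - p) *\<^sub>R 1)"
    using p assms by (intro concave_onD[OF S_concave]) auto
  then have "p * S x + (1 - p) * S 1 \<le> S (p * x + (1 - p) * 1)" by simp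
  then have "(1 - y) / (1 - x) * S x \<le> S y"
    unfolding y[symmetric] p_def[symmetric] using S_outside[of 1] by simp
  then show ?thesis using assms by (simp add: pos_le_divide_eq mult.commute)
qed

text \<open>A monotone bounded quotient converges to its supremum. The tent at 0 bounds the supremum
  below by 1, and the upper tent bounds every quotient by \<tau>.\<close>

lemma slope_limit:
  obtains l where "1 \<le> l" "l \<le> \<tau>" "((\<lambda>x. S x / (1 - x)) \<longlongrightarrow> l) (at_left 1)"
proof
  let ?q = "\<lambda>x. S x / (1 - x)"
  define l where "l = (SUP x\<in>{0..<1}. ?q x)"
  have le: "?q x \<le> \<tau>" if "x \<in> {0..<1}" for x
    using S_le[of x] that by (simp add: field_simps)
  then have bdd: "bdd_above (?q ` {0..<1})" by (intro bdd_aboveI2)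
  have le_l: "?q x \<le> l" if "x \<in> {0..<1}" for x
    unfolding l_def using that bdd by (intro cSUP_upper)
  show "l \<le> \<tau>" unfolding l_def by (intro cSUP_least le) auto
  show "1 \<le> l" using S_ge_tent[of 0] le_l[of 0] by simp
  show "(?q \<longlongrightarrow> l) (at_left 1)"
  proof (rule order_tendstoI)
    fix b assume "b < l"
    then obtain x where x: "x \<in> {0..<1}" "b < ?q x"
      unfolding l_def using less_cSUP_iff[OF _ bdd] by auto
    then have "b < ?q y" if "x < y" "y < 1" for y
      using slope_mono[of x y] that by auto
    then show "\<forall>\<^sub>F y in at_left 1. b < ?q y"
      using x(1) by (auto simp: eventually_at_left_real intro!: eventually_at_leftI[of x])
  next
    fix b assume "l < b"
    then have "?q y < b" if "0 < y" "y < 1" for y using le_l[of y] that by auto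
    then show "\<forall>\<^sub>F y in at_left 1. ?q y < b" by (auto intro!: eventually_at_leftI[of 0])
  qed
qed

lemma one_sided_derivs_S:
  obtains l where "1 \<le> l" "l \<le> \<tau>" "has_left_deriv S 1 (ereal (- l))" "has_right_deriv S (-1) (ereal l)"
proof -
  obtain l where l: "1 \<le> l" "l \<le> \<tau>" "((\<lambda>x. S x / (1 - x)) \<longlongrightarrow> l) (at_left 1)"
    by (rule slope_limit)
  have S1: "S 1 = 0" "S (-1) = 0" by (auto intro: S_outside)
  have "((\<lambda>x. (S x - S 1) / (x - 1)) \<longlongrightarrow> - l) (at_left 1)"
    using tendsto_minus[OF l(3)] S1 by (simp add: minus_divide_right)
  then have left: "has_left_deriv S 1 (ereal (- l))"
    unfolding has_left_deriv_def by (rule tendsto_ereal)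
  have "((\<lambda>x. S (- x) / (1 - (- x))) \<longlongrightarrow> l) (at_right (-1))"
    using l(3) unfolding at_left_minus[of 1] filterlim_filtermap by simp
  then have "((\<lambda>x. (S x - S (-1)) / (x - (-1))) \<longlongrightarrow> l) (at_right (-1))"
    using S1 by (simp add: S_minus add.commute)
  then have right: "has_right_deriv S (-1) (ereal l)"
    unfolding has_right_deriv_def by (rule tendsto_ereal)
  show thesis using that[OF l(1,2) left right] .
qed

end

section \<open>Logarithmic run costs\<close>

text \<open>The logarithms telescope: growing a run from \<open>r \<ge> m\<close> to
  \<open>k\<close> costs \<open>2 * log 2 (k / r)\<close> in total. Cost 1 up to \<open>m\<close>
  means that the potential vanishes on short runs.\<close>

definition log_cost :: "nat \<Rightarrow> nat \<Rightarrow> real" where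
  "log_cost m k = (if k = 0 then 2 else if k \<le> m then 1 else 2 * log 2 (real k / real (k - 1)))"

lemma run_potential_log_cost:
  assumes m: "m \<ge> 3"
  shows "run_potential (log_cost m)"
proof
  show "antimono (log_cost m)"
    unfolding antimono_iff_le_Suc
  proof
    fix k
    have *: "2 * log 2 (real (Suc k) / real k) \<le> 1" if "k \<ge> m"
    proof -
      have k: "real k \<ge> 3" using that m by linarith
      then have "3 * real k \<le> real k * real k" by (intro mult_right_mono) auto
      then have "1 + 2 * real k \<le> real k * real k" using k by linarith
      then have "(real (Suc k) / real k) ^ 2 \<le> 2" using k by (simp add: power2_eq_square field_simps)
      then have "log 2 ((real (Suc k) / real k) ^ 2) \<le> log 2 2"
        using k by (subst log_le_cancel_iff) auto
      then show ?thesis using k by (simp add: log_nat_power)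
    qed
    have **: "2 * log 2 (real (Suc k) / real k) \<le> 2 * log 2 (real k / real (k - 1))" if "k > m"
    proof -
      have "k = Suc (k - 1)" "k - 1 > 0" using that m by auto
      then obtain j where j: "k = Suc j" "j > 0" by blast
      show ?thesis using j by (simp add: log_le_cancel_iff field_simps)
    qed
    show "log_cost m (Suc k) \<le> log_cost m k"
      using * ** by (cases "k = 0"; cases "k < m"; cases "k = m") (auto simp: log_cost_def)
  qed
  show "log_cost m k \<ge> 0" for k
  proof (cases "k \<le> m")
    case False
    then have "1 \<le> real k / real (k - 1)" using m by simp
    then show ?thesis using False by (simp add: log_cost_def del: of_nat_diff)
  qed (simp add: log_cost_def)
  have "(\<lambda>k. 2 * log 2 (real (Suc k) / real k)) \<longlonglongrightarrow> 2 * log 2 1"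
    by (intro tendsto_mult tendsto_const tendsto_log LIMSEQ_Suc_n_over_n) auto
  moreover have "\<forall>\<^sub>F k in sequentially. 2 * log 2 (real (Suc k) / real k) = log_cost m (Suc k)"
    using eventually_ge_at_top[of m] by (rule eventually_mono) (auto simp: log_cost_def)
  ultimately have "(\<lambda>k. log_cost m (Suc k)) \<longlonglongrightarrow> 2 * log 2 1"
    by (rule Lim_transform_eventually)
  then show "log_cost m \<longlonglongrightarrow> 0" by (simp add: filterlim_sequentially_Suc)
qed (use m in \<open>auto simp: log_cost_def\<close>)

lemma ex_tent_bounded:
  assumes \<tau>: "\<tau> > 1"
  shows "\<exists>a. tent_bounded a \<tau>"
proof -
  define x where "x = 2 powr (- \<tau>)"
  have x: "0 < x" "x < 1 / 2"
    using \<tau> powr_less_mono[of "- \<tau>" "-1" 2] by (auto simp: x_def powr_minus)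
  define \<rho> where "\<rho> = x / (1 - x)"
  have \<rho>: "0 < \<rho>" "\<rho> < 1" using x by (auto simp: \<rho>_def field_simps)
  have "(\<lambda>n. real n * x ^ n) \<longlonglongrightarrow> 0" using x by (intro powser_times_n_limit_0) auto
  then have "(\<lambda>n. real n * x ^ n / x) \<longlonglongrightarrow> 0 / x" by (intro tendsto_divide tendsto_const) (use x in auto)
  then have "\<forall>\<^sub>F n in sequentially. real n * x ^ n / x < 1 - \<rho>"
    using \<rho> by (intro order_tendstoD(2)) auto
  then obtain n0 where n0: "\<And>n. n \<ge> n0 \<Longrightarrow> real n * x ^ n / x < 1 - \<rho>"
    by (auto simp: eventually_sequentially)
  define m where "m = max 3 n0"
  have m3: "m \<ge> 3" by (simp add: m_def)
  have "real m * x ^ m / x < 1 - \<rho>" by (rule n0) (simp add: m_def)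
  moreover have "x ^ m = x * x ^ (m - 1)" using m3 by (simp add: power_eq_if)
  ultimately have m: "\<rho> + real m * x ^ (m - 1) \<le> 1" using x by simp
  define a where "a = log_cost m"
  define g where "g r = (if r \<le> m then \<rho> + real m * x ^ (m - r) else real r)" for r
  \<comment> \<open>Past \<open>m\<close> the weight of a run of ones grown from length \<open>r\<close> to \<open>k\<close> is at most \<open>(r / k)\<^sup>2\<close>,
    whose sum over \<open>k \<ge> r\<close> is of order \<open>r\<close>; this dictates the linear growth of \<open>g\<close>.\<close>
  define h where "h \<omega> = (if \<omega> 0 then g (run_length \<omega>) else \<rho>)" for \<omega> :: omega
  interpret run_potential a unfolding a_def by (rule run_potential_log_cost[OF m3])
  have g1: "g 1 \<le> 1" using m m3 by (simp add: g_def)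
  have g_step: "x powr (a (Suc r)) * g (Suc r) + x * \<rho> \<le> g r" if r: "r > 0" for r
  proof (cases "r < m")
    case True
    then have "a (Suc r) = 1" by (simp add: a_def log_cost_def)
    moreover have "x ^ (m - r) = x * x ^ (m - Suc r)" using True by (simp add: Suc_diff_Suc[symmetric])
    moreover have "2 * x * \<rho> \<le> 1 * \<rho>" using x \<rho> by (intro mult_right_mono) auto
    ultimately show ?thesis using True x by (simp add: g_def algebra_simps)
  next
    case False
    have ln: "a (Suc r) = 2 * log 2 (real (Suc r) / real r)" using False r by (simp add: a_def log_cost_def)
    have "x powr (a (Suc r)) = 2 powr (- (\<tau> * a (Suc r)))" by (simp add: x_def powr_powr)
    also have "\<dots> \<le> 2 powr (- a (Suc r))"
      using \<tau> a_nonneg[of "Suc r"] mult_right_mono[of 1 \<tau> "a (Suc r)"] by (intro powr_mono) auto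
    also have "\<dots> = (2 powr (log 2 (real (Suc r) / real r))) powr (- 2)"
      unfolding powr_powr ln by (simp add: mult.commute)
    also have "\<dots> = (real (Suc r) / real r) powr (- 2)" using r by simp
    also have "\<dots> = (real r / real (Suc r)) ^ 2"
      using r by (simp add: powr_minus powr_divide power_divide field_simps)
    finally have "x powr (a (Suc r)) * g (Suc r) \<le> (real r / real (Suc r)) ^ 2 * real (Suc r)"
      unfolding g_def using False by (simp del: of_nat_Suc)
    also have "\<dots> = real r * real r / real (Suc r)" by (simp add: power2_eq_square)
    also have "\<dots> = real r - real r / real (Suc r)" by (simp add: field_simps)
    finally have 1: "x powr (a (Suc r)) * g (Suc r) \<le> real r - real r / real (Suc r)" .
    have "x * \<rho> \<le> 1 / 2 * 1" using x \<rho> by (intro mult_mono) auto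
    also have "\<dots> \<le> real r / real (Suc r)" using r by (simp add: field_simps)
    finally have "x powr (a (Suc r)) * g (Suc r) + x * \<rho> \<le> real r" using 1 by linarith
    also have "\<dots> \<le> g r" using False \<rho> by (auto simp: g_def)
    finally show ?thesis .
  qed
  have g_ge: "\<rho> \<le> g r" for r
    using \<rho> m3 x by (auto simp: g_def)
  have a1: "a 1 = 1" using m3 by (simp add: a_def log_cost_def)
  have weight: "2 powr (- \<tau> * c) = x powr c" for c by (simp add: x_def powr_powr)
  show ?thesis
  proof (intro exI[of _ a] tent_bounded.intro tent_bounded_axioms.intro)
    show "run_potential a" by (rule run_potential_axioms)
    show "\<tau> > 0" using \<tau> by simp
    fix \<alpha> :: real assume \<alpha>: "\<bar>\<alpha>\<bar> \<le> 1"
    show "hausdorff_dim dist_omega (E_set (run_fun a) \<alpha>) \<le> ennreal (\<tau> * (1 - \<bar>\<alpha>\<bar>))"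
    proof (rule hausdorff_dim_le_of_subinvariant[where h = h and c = \<rho>])
      fix \<omega> :: omega assume nc: "\<exists>k. \<omega> k \<noteq> \<omega> 0"
      show "\<rho> \<le> h \<omega>" using g_ge by (simp add: h_def)
      define r where "r = run_length \<omega>"
      have r: "r > 0" unfolding r_def by (rule run_length_pos[OF nc])
      have cost_same: "run_cost a (\<omega> 0 ## \<omega>) = a (Suc r)"
        using ex_change_build[OF nc, of "\<omega> 0"] run_length_build_same[OF nc] by (simp add: run_cost_def r_def)
      have cost_diff: "run_cost a (b ## \<omega>) = 1" "run_length (b ## \<omega>) = 1" if "b \<noteq> \<omega> 0" for b
        using ex_change_build[OF nc, of b] run_length_build_diff[of b \<omega>] that a1 by (simp_all add: run_cost_def)
      show "(\<Sum>b\<in>UNIV. 2 powr (- \<tau> * (1 - run_fun a (b ## \<omega>))) * h (b ## \<omega>)) \<le> h \<omega>"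
      proof (cases "\<omega> 0")
        case True
        have "(\<Sum>b\<in>UNIV. 2 powr (- \<tau> * (1 - run_fun a (b ## \<omega>))) * h (b ## \<omega>))
            = x powr (a (Suc r)) * g (Suc r) + x * \<rho>"
          using True x cost_same cost_diff[of False] run_length_build_same[OF nc]
          unfolding weight UNIV_bool by (simp add: run_fun_def h_def r_def)
        then show ?thesis using g_step[OF r] True by (simp add: h_def r_def)
      next
        case False
        have "(\<Sum>b\<in>UNIV. 2 powr (- \<tau> * (1 - run_fun a (b ## \<omega>))) * h (b ## \<omega>))
            = x powr (2 - a (Suc r)) * \<rho> + x * g 1"
          using False x cost_same cost_diff[of True]
          unfolding weight UNIV_bool by (simp add: run_fun_def h_def)
        also have "\<dots> \<le> x powr 1 * \<rho> + x * 1"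
        proof (intro add_mono mult_right_mono mult_left_mono powr_mono')
          show "1 \<le> 2 - a (Suc r)" using antimonoD[OF antimono_a, of 1 "Suc r"] a1 by simp
        qed (use x \<rho> g1 in auto)
        also have "\<dots> = \<rho>" using x by (simp add: \<rho>_def field_simps)
        finally show ?thesis using False by (simp add: h_def)
      qed
    qed (use \<tau> \<rho> \<alpha> in auto)
  qed
qed

theorem theorem5p2p1:
  shows "(\<exists>f\<in>C0_omega.
            continuous_on UNIV (birkhoff_spectrum f) \<and> alpha_min f = -1 \<and> alpha_max f = 1 \<and>
            (\<exists>L. has_left_deriv (birkhoff_spectrum f) (alpha_max f) L \<and> -\<infinity> < L) \<and>
            (\<exists>R. has_right_deriv (birkhoff_spectrum f) (alpha_min f) R \<and> R < \<infinity>)) \<and>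
         (\<forall>\<eta>::real. 0 < \<eta> \<longrightarrow>
            (\<exists>f\<in>C0_omega.
               continuous_on UNIV (birkhoff_spectrum f) \<and> alpha_min f = -1 \<and> alpha_max f = 1 \<and>
               (\<exists>L. has_left_deriv (birkhoff_spectrum f) (alpha_max f) L \<and> -\<infinity> < L \<and>
                    \<bar>L + 1\<bar> < ereal \<eta>) \<and>
               (\<exists>R. has_right_deriv (birkhoff_spectrum f) (alpha_min f) R \<and> R < \<infinity> \<and>
                    \<bar>R - 1\<bar> < ereal \<eta>)))"
    (is "(\<exists>f\<in>C0_omega. ?P f) \<and> (\<forall>\<eta>. 0 < \<eta> \<longrightarrow> (\<exists>f\<in>C0_omega. ?Q \<eta> f))")
proof -
  have main: "\<exists>f\<in>C0_omega. ?Q \<eta> f" if eta: "\<eta> > 0" for \<eta> :: real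
  proof -
    obtain a where "tent_bounded a (1 + \<eta> / 2)" using ex_tent_bounded[of "1 + \<eta> / 2"] eta by auto
    then interpret tent_bounded a "1 + \<eta> / 2" .
    obtain l where l: "1 \<le> l" "l \<le> 1 + \<eta> / 2" "has_left_deriv S 1 (ereal (- l))"
        "has_right_deriv S (-1) (ereal l)"
      by (rule one_sided_derivs_S)
    have "\<bar>ereal (- l) + 1\<bar> < ereal \<eta>" "\<bar>ereal l - 1\<bar> < ereal \<eta>"
      using l(1,2) eta by (simp_all add: one_ereal_def)
    then have "?Q \<eta> (run_fun a)"
      unfolding alpha_max alpha_min using l(3,4) S_continuous by auto
    then show ?thesis using run_fun_C0 by blast
  qed
  moreover have "\<exists>f\<in>C0_omega. ?P f"
    using main[OF zero_less_one] by blast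
  ultimately show ?thesis by blast
qed

end
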